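(* Let $\mathcal{L}$ be a non-degenerate probability law supported on $[0,\infty)$, let $(X_{i,j})_{i,j\ge 1}$ be i.i.d. with law $\mathcal{L}$, and let $(\theta_i)_{i\ge1}\in(0,\infty)^{\mathbb{N}}$ be a (possibly random) sequence. For each $n$, let $A=(\theta_iX_{i,j})_{i,j\in[n]}$, let $Q=A-D$ be the associated Markov generator with $D$ the diagonal matrix of row sums of $A$, let $\pi_Q$ be its invariant distribution, and let $q_i=|Q_{i,i}|=\sum_{j\ne i}Q_{i,j}$. Let $\nu_q$ and $\nu_\theta$ be the probability distributions on $[n]$ with $\nu_q(i)\propto q_i^{-1}$ and $\nu_\theta(i)\propto\theta_i^{-1}$. If $\mathcal{L}$ has a finite $p$-th moment for some $p>4$, then, for every $a<\min\{\tfrac12,\,1-\tfrac4p\}$ and for each $\nu\in\{\nu_q,\nu_\theta\}$, $$\|\pi_Q-\nu\|_{\mathrm{TV}}=O(n^{-a})\quad\text{almost surely, as } n\to\infty.$$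
   Context: Notation: $[n]=\{1,\dots,n\}$. For a signed measure $\nu$ on $[n]$, $\|\nu\|_{\mathrm{TV}}=\frac12\sum_{i\in[n]}|\nu(i)|$. "Non-degenerate" means that $\mathcal{L}$ is not a point mass; $\mathcal{L}$ may have an atom at $0$. No restriction is placed on the vertex weights $\theta_i$ beyond positivity. All matrices depend on $n$ and are built from the same infinite array $(X_{i,j})_{i,j\ge1}$ and the same infinite sequence $(\theta_i)_{i\ge1}$. The generator $Q$ has off-diagonal entries $Q_{i,j}=\theta_iX_{i,j}$ $(i\neq j)$ and $Q_{i,i}=-\sum_{j\ne i}\theta_iX_{i,j}$. The invariant distribution $\pi_Q$ is the unique probability (row) vector with $\pi_Q Q=0$. Let $\widehat A$ be $A$ with its diagonal entries replaced by $0$. Almost surely, for all sufficiently large $n$, both $A$ and $\widehat A$ are primitive; on this event $Q$ is irreducible, $\pi_Q$ exists and is unique, and all $q_i>0$. The statement concerns such $n$. "$Z_n=O(n^{-a})$ a.s." means that almost surely there are a finite (possibly random) constant $C$ and a (possibly random) $N$ with $|Z_n|\le Cn^{-a}$ for all $n\ge N$. *)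

theory Defs
  imports "HOL-Probability.Probability" "HOL-Library.Landau_Symbols"
begin

text \<open>
  Since the dimension \<open>n\<close> varies within the statement, vectors and matrices of size \<open>n\<close> are
  functions on \<^typ>\<open>nat\<close> of which only the entries with indices in \<open>{1..n}\<close> matter.
\<close>

definition weighted_matrix :: "(nat \<Rightarrow> real) \<Rightarrow> (nat \<Rightarrow> nat \<Rightarrow> real) \<Rightarrow> nat \<Rightarrow> nat \<Rightarrow> real" where
  "weighted_matrix \<theta> x i j = \<theta> i * x i j"

text \<open>
  \<open>Q = A - D\<close>, where the diagonal matrix \<open>D\<close> holds the full row sums of \<open>A\<close>. The diagonal of \<open>A\<close>
  cancels, so that the diagonal entry of \<open>Q\<close> is minus the sum of the off-diagonal entries in its row.
\<close>

definition generator :: "nat \<Rightarrow> (nat \<Rightarrow> nat \<Rightarrow> real) \<Rightarrow> nat \<Rightarrow> nat \<Rightarrow> real" where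
  "generator n A i j = A i j - (if i = j then \<Sum>k=1..n. A i k else 0)"

text \<open>
  Vectors representing distributions on \<open>{1..n}\<close> are required to vanish outside \<open>{1..n}\<close>, as
  otherwise no such representative would be unique.
\<close>

definition prob_vector :: "nat \<Rightarrow> (nat \<Rightarrow> real) \<Rightarrow> bool" where
  "prob_vector n v \<longleftrightarrow>
     (\<forall>i\<in>{1..n}. 0 \<le> v i) \<and> (\<Sum>i=1..n. v i) = 1 \<and> (\<forall>i. i \<notin> {1..n} \<longrightarrow> v i = 0)"

definition is_invariant_dist :: "nat \<Rightarrow> (nat \<Rightarrow> nat \<Rightarrow> real) \<Rightarrow> (nat \<Rightarrow> real) \<Rightarrow> bool" where
  "is_invariant_dist n Q v \<longleftrightarrow> prob_vector n v \<and> (\<forall>j\<in>{1..n}. (\<Sum>i=1..n. v i * Q i j) = 0)"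

text \<open>Unspecified unless there is exactly one invariant distribution.\<close>

definition invariant_dist :: "nat \<Rightarrow> (nat \<Rightarrow> nat \<Rightarrow> real) \<Rightarrow> nat \<Rightarrow> real" where
  "invariant_dist n Q = (THE v. is_invariant_dist n Q v)"

definition exit_rate :: "(nat \<Rightarrow> nat \<Rightarrow> real) \<Rightarrow> nat \<Rightarrow> real" where
  "exit_rate Q i = \<bar>Q i i\<bar>"

text \<open>The distribution on \<open>{1..n}\<close> proportional to \<open>1 / w i\<close>, for positive weights \<open>w\<close>.\<close>

definition recip_dist :: "nat \<Rightarrow> (nat \<Rightarrow> real) \<Rightarrow> nat \<Rightarrow> real" where
  "recip_dist n w i = (if i \<in> {1..n} then inverse (w i) / (\<Sum>k=1..n. inverse (w k)) else 0)"

definition tv_norm :: "nat \<Rightarrow> (nat \<Rightarrow> real) \<Rightarrow> real" where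
  "tv_norm n v = (1 / 2) * (\<Sum>i=1..n. \<bar>v i\<bar>)"

end

theory Submission
  imports Defs "HOL-Real_Asymp.Real_Asymp"
begin

text \<open>
  Let \<open>r i\<close> be the sum of the off-diagonal entries \<open>X i j\<close> in row \<open>i\<close>, so that \<open>q i = \<theta> i * r i\<close>,
  and let \<open>P i j = X i j / r i\<close> for \<open>i \<noteq> j\<close> and \<open>P i i = 0\<close>. If \<open>v\<close> is invariant for the generator,
  \<open>u i = v i * q i\<close> is fixed by \<open>P\<close>, in which the vertex weights have cancelled. Suppose that,
  after normalization, \<open>n * u i = 1 + O(n powr - a)\<close> uniformly in \<open>i\<close>. Then the weights
  \<open>v i \<propto> u i / q i\<close> and \<open>1 / q i\<close> agree up to such relative errors, and so do, as \<open>r i\<close> is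
  \<open>n * mean\<close> up to the same errors, \<open>v i\<close> and \<open>1 / \<theta> i\<close>. Uniform relative errors carry over to the
  total variation distance (\<open>normalized_weights_close\<close>) for arbitrary vertex weights.

  The uniform estimate of \<open>u\<close> rests on a contraction. On row vectors of total mass \<open>0\<close>, \<open>P\<close> acts as
  \<open>E = P - 1 / n\<close>, and \<open>E E\<^sup>T = P P\<^sup>T - 1 / n\<close> because the rows of \<open>P\<close> sum to \<open>1\<close>. Two distinct rows
  of \<open>P\<close> have inner product close to \<open>1 / n\<close>, and a row has squared norm of order \<open>1 / n\<close>.
  Therefore all absolute row sums of \<open>E E\<^sup>T\<close> are small, and \<open>P\<close> at least halves the Euclidean norm
  of vectors of mass \<open>0\<close> (\<open>step_contracts\<close>). This yields existence and uniqueness of \<open>u\<close>. It also bounds the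
  Euclidean distance of \<open>u\<close> to the uniform vector by the deviation of the column sums of \<open>P\<close> from
  \<open>1\<close>, and one application of the Cauchy--Schwarz inequality turns the Euclidean bound into a
  uniform one (\<open>stationary_near_uniform\<close>).

  It remains to see that almost surely, eventually, row and column sums are
  \<open>n * mean + O(n powr (1 - a))\<close>, sums of squares along rows and columns are \<open>O(n)\<close>, and the inner
  product of two rows is \<open>n * mean\<^sup>2\<close> up to a small multiple of \<open>n\<close> (\<open>AE_eventually_balanced\<close>).
  The moment condition \<open>p > 4\<close> permits clipping the entries at a power \<open>n powr \<beta>\<close> with
  \<open>\<beta> < 1 / 2\<close> without changing any but finitely many of them. Sums of clipped entries have
  stretched-exponential tails by a Bernstein inequality, which absorb the union bound over rows and
  pairs of rows.
\<close>

section \<open>Stochastic matrices with nearly constant Gram matrix\<close>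

text \<open>
  If every \<open>P i j\<close> is exactly \<open>1 / N\<close> with \<open>N = card I\<close>, every entry of the Gram matrix \<open>P P\<^sup>T\<close> is
  \<open>1 / N\<close>. The condition \<open>gram\<close> is a weak form of this: the matrix \<open>G = P P\<^sup>T - 1 / N\<close> has small
  absolute row sums. It constrains inner products of rows instead of single entries, so that it can
  hold when many entries of \<open>P\<close> vanish.
\<close>

locale near_flat_kernel =
  fixes I :: "'i set" and P :: "'i \<Rightarrow> 'i \<Rightarrow> real"
  assumes fin: "finite I" and ne: "I \<noteq> {}"
    and nonneg: "\<And>i j. i \<in> I \<Longrightarrow> j \<in> I \<Longrightarrow> 0 \<le> P i j"
    and row: "\<And>i. i \<in> I \<Longrightarrow> (\<Sum>j\<in>I. P i j) = 1"
    and gram: "\<And>i. i \<in> I \<Longrightarrow> (\<Sum>k\<in>I. \<bar>(\<Sum>j\<in>I. P i j * P k j) - 1 / card I\<bar>) \<le> 1 / 4"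
begin

definition step :: "('i \<Rightarrow> real) \<Rightarrow> 'i \<Rightarrow> real" where
  "step v j = (\<Sum>i\<in>I. v i * P i j)"

definition stationary :: "('i \<Rightarrow> real) \<Rightarrow> bool" where
  "stationary u \<longleftrightarrow> (\<Sum>i\<in>I. u i) = 1 \<and> (\<forall>j\<in>I. step u j = u j)"

lemma card_pos: "0 < card I"
  using fin ne by (simp add: card_gt_0_iff)

lemma sum_step: "(\<Sum>j\<in>I. step v j) = (\<Sum>i\<in>I. v i)"
proof -
  have "(\<Sum>j\<in>I. step v j) = (\<Sum>i\<in>I. v i * (\<Sum>j\<in>I. P i j))"
    unfolding step_def by (subst sum.swap) (simp add: sum_distrib_left)
  then show ?thesis by (simp add: row)
qed

lemma step_diff: "step (\<lambda>i. v i - w i) j = step v j - step w j"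
  unfolding step_def by (simp add: left_diff_distrib sum_subtractf)

text \<open>
  For \<open>z\<close> of total mass \<open>0\<close> the constant part of \<open>P P\<^sup>T\<close> is invisible, so that the squared norm of
  \<open>z P\<close> is \<open>z G z\<^sup>T\<close>. By the Schur test a symmetric quadratic form is at most its largest absolute
  row sum times the squared norm. Hence \<open>P\<close> at least halves Euclidean norms of such vectors.
\<close>

lemma step_contracts:
  assumes z: "(\<Sum>i\<in>I. z i) = 0"
  shows "(\<Sum>j\<in>I. (step z j)\<^sup>2) \<le> 1 / 4 * (\<Sum>i\<in>I. (z i)\<^sup>2)"
proof -
  define H where "H i k = (\<Sum>j\<in>I. P i j * P k j)" for i k
  define G where "G i k = H i k - 1 / card I" for i k
  have G_sym: "G i k = G k i" for i k
    by (simp add: G_def H_def mult.commute)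
  have "(\<Sum>j\<in>I. (step z j)\<^sup>2) = (\<Sum>j\<in>I. \<Sum>i\<in>I. \<Sum>k\<in>I. z i * z k * (P i j * P k j))"
    unfolding step_def power2_eq_square sum_product
    by (intro sum.cong refl) (simp add: algebra_simps)
  also have "\<dots> = (\<Sum>i\<in>I. \<Sum>j\<in>I. \<Sum>k\<in>I. z i * z k * (P i j * P k j))"
    by (rule sum.swap)
  also have "\<dots> = (\<Sum>i\<in>I. \<Sum>k\<in>I. z i * z k * H i k)"
    unfolding H_def sum_distrib_left by (intro sum.cong refl sum.swap)
  \<comment> \<open>The constant part of the Gram matrix contributes a multiple of the squared total mass.\<close>
  also have "\<dots> = (\<Sum>i\<in>I. \<Sum>k\<in>I. z i * z k * G i k) + (\<Sum>i\<in>I. z i) * (\<Sum>k\<in>I. z k) / card I"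
    unfolding G_def sum_product sum_divide_distrib sum.distrib[symmetric]
    by (intro sum.cong refl) (simp add: algebra_simps)
  also have "\<dots> = (\<Sum>i\<in>I. \<Sum>k\<in>I. z i * z k * G i k)"
    using z by simp
  also have "\<dots> \<le> (\<Sum>i\<in>I. \<Sum>k\<in>I. ((z i)\<^sup>2 + (z k)\<^sup>2) / 2 * \<bar>G i k\<bar>)"
  proof (intro sum_mono)
    fix i k
    have "z i * z k * G i k \<le> \<bar>z i * z k\<bar> * \<bar>G i k\<bar>"
      by (metis abs_ge_self abs_mult)
    also have "\<bar>z i * z k\<bar> \<le> ((z i)\<^sup>2 + (z k)\<^sup>2) / 2"
      using sum_squares_bound[of "\<bar>z i\<bar>" "\<bar>z k\<bar>"] by (simp add: abs_mult)
    finally show "z i * z k * G i k \<le> ((z i)\<^sup>2 + (z k)\<^sup>2) / 2 * \<bar>G i k\<bar>"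
      by (simp add: mult_right_mono)
  qed
  also have "\<dots> = (\<Sum>i\<in>I. \<Sum>k\<in>I. (z i)\<^sup>2 / 2 * \<bar>G i k\<bar>) + (\<Sum>i\<in>I. \<Sum>k\<in>I. (z k)\<^sup>2 / 2 * \<bar>G i k\<bar>)"
    unfolding sum.distrib[symmetric] by (intro sum.cong refl) (simp add: field_simps)
  also have "(\<Sum>i\<in>I. \<Sum>k\<in>I. (z k)\<^sup>2 / 2 * \<bar>G i k\<bar>) = (\<Sum>i\<in>I. \<Sum>k\<in>I. (z i)\<^sup>2 / 2 * \<bar>G i k\<bar>)"
    by (subst sum.swap) (simp add: G_sym)
  also have "(\<Sum>i\<in>I. \<Sum>k\<in>I. (z i)\<^sup>2 / 2 * \<bar>G i k\<bar>) + (\<Sum>i\<in>I. \<Sum>k\<in>I. (z i)\<^sup>2 / 2 * \<bar>G i k\<bar>)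
      = (\<Sum>i\<in>I. (z i)\<^sup>2 * (\<Sum>k\<in>I. \<bar>G i k\<bar>))"
    unfolding sum.distrib[symmetric] sum_distrib_left by (intro sum.cong refl) simp
  also have "\<dots> \<le> (\<Sum>i\<in>I. (z i)\<^sup>2 * (1 / 4))"
    using gram by (intro sum_mono mult_left_mono) (auto simp: G_def H_def)
  finally show ?thesis by (simp add: sum_distrib_left mult.commute)
qed

lemma stationary_unique:
  assumes "stationary u" "stationary v" "i \<in> I"
  shows "u i = v i"
proof -
  define z where "z = (\<lambda>i. u i - v i)"
  have "(\<Sum>i\<in>I. z i) = 0" and fixed: "step z j = z j" if "j \<in> I" for j
    using assms that unfolding z_def stationary_def by (auto simp: step_diff sum_subtractf)
  then have "(\<Sum>j\<in>I. (z j)\<^sup>2) \<le> 1 / 4 * (\<Sum>i\<in>I. (z i)\<^sup>2)"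
    using step_contracts[of z] ne by auto
  then have "(\<Sum>j\<in>I. (z j)\<^sup>2) = 0"
    using sum_nonneg[of I "\<lambda>j. (z j)\<^sup>2"] by auto
  then have "(z i)\<^sup>2 = 0"
    using fin \<open>i \<in> I\<close> by (subst (asm) sum_nonneg_eq_0_iff) auto
  then show ?thesis by (simp add: z_def)
qed

text \<open>
  Contraction replaces the Perron--Frobenius theorem: iterating \<open>step\<close> from the uniform
  distribution, successive differences have mass \<open>0\<close>, so that they decay geometrically. The limit
  inherits nonnegativity from the iterates.
\<close>

lemma stationary_exists: "\<exists>u. stationary u \<and> (\<forall>i\<in>I. 0 \<le> u i)"
proof -
  define v where "v k = (step ^^ k) (\<lambda>_. 1 / card I)" for k :: nat
  have v_Suc: "v (Suc k) = step (v k)" for k by (simp add: v_def)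
  have v_sum: "(\<Sum>i\<in>I. v k i) = 1" for k
  proof (induction k)
    case 0 show ?case using card_pos by (simp add: v_def)
  qed (simp add: v_Suc sum_step)
  have v_nonneg: "0 \<le> v k i" if "i \<in> I" for k i
    using that
  proof (induction k arbitrary: i)
    case 0 show ?case by (simp add: v_def)
  next
    case (Suc k) then show ?case unfolding v_Suc step_def by (intro sum_nonneg mult_nonneg_nonneg nonneg)
  qed
  define d where "d k i = v (Suc k) i - v k i" for k i
  define C where "C = (\<Sum>i\<in>I. (d 0 i)\<^sup>2)"
  have C_nonneg: "0 \<le> C" unfolding C_def by (intro sum_nonneg) auto
  have d_Suc: "d (Suc k) = step (d k)" for k
    by (rule ext) (simp add: d_def[abs_def] step_diff v_Suc)
  have d_small: "(\<Sum>i\<in>I. (d k i)\<^sup>2) \<le> C * (1 / 4) ^ k" for k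
  proof (induction k)
    case 0 show ?case by (simp add: C_def)
  next
    case (Suc k)
    have "(\<Sum>i\<in>I. d k i) = 0" by (simp add: d_def sum_subtractf v_sum)
    from step_contracts[OF this] show ?case using Suc by (simp add: d_Suc)
  qed
  have d_bound: "\<bar>d k i\<bar> \<le> sqrt C * (1 / 2) ^ k" if "i \<in> I" for k i
  proof -
    have "(d k i)\<^sup>2 \<le> C * (1 / 4) ^ k"
      using member_le_sum[of i I "\<lambda>i. (d k i)\<^sup>2"] that fin d_small[of k] by simp
    also have "C * (1 / 4) ^ k = (sqrt C * (1 / 2) ^ k)\<^sup>2"
      using C_nonneg
      by (simp add: power_mult_distrib power2_eq_square power_mult_distrib[symmetric] mult.commute
          mult.left_commute mult.assoc[symmetric])
    finally show ?thesis
      using abs_le_square_iff[of "d k i" "sqrt C * (1 / 2) ^ k"] C_nonneg by simp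
  qed
  have conv: "convergent (\<lambda>k. v k i)" if "i \<in> I" for i
  proof -
    have "summable (\<lambda>k. d k i)"
    proof (rule summable_comparison_test)
      show "\<exists>N. \<forall>k\<ge>N. norm (d k i) \<le> sqrt C * (1 / 2) ^ k"
        using d_bound[OF that] by auto
      show "summable (\<lambda>k. sqrt C * (1 / 2) ^ k)"
        by (intro summable_mult summable_geometric) simp
    qed
    then have "convergent (\<lambda>N. (\<Sum>k<N. d k i) + v 0 i)"
      by (intro convergent_add convergent_const) (simp add: summable_iff_convergent)
    moreover have "(\<Sum>k<N. d k i) + v 0 i = v N i" for N
      unfolding d_def using sum_lessThan_telescope[of "\<lambda>k. v k i" N] by simp
    ultimately show ?thesis by simp
  qed
  define u where "u i = lim (\<lambda>k. v k i)" for i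
  have lim: "(\<lambda>k. v k i) \<longlonglongrightarrow> u i" if "i \<in> I" for i
    using conv[OF that] by (simp add: u_def convergent_LIMSEQ_iff)
  have "(\<lambda>k. \<Sum>i\<in>I. v k i) \<longlonglongrightarrow> (\<Sum>i\<in>I. u i)"
    by (intro tendsto_sum lim)
  then have "(\<Sum>i\<in>I. u i) = 1"
    by (simp add: v_sum LIMSEQ_const_iff)
  moreover have "step u j = u j" if "j \<in> I" for j
  proof -
    have "(\<lambda>k. step (v k) j) \<longlonglongrightarrow> step u j"
      unfolding step_def by (intro tendsto_intros lim)
    moreover have "(\<lambda>k. step (v k) j) \<longlonglongrightarrow> u j"
      using LIMSEQ_Suc[OF lim[OF that]] by (simp add: v_Suc)
    ultimately show ?thesis by (rule LIMSEQ_unique)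
  qed
  moreover have "0 \<le> u i" if "i \<in> I" for i
    using lim[OF that] v_nonneg[OF that] by (intro LIMSEQ_le_const) auto
  ultimately show ?thesis unfolding stationary_def by blast
qed

text \<open>
  Write \<open>w = u - 1 / N\<close> and let \<open>e\<close> be the defect \<open>(column sum - 1) / N\<close> of the uniform vector, so
  that \<open>w = e + w P\<close>. Since \<open>P\<close> at least halves the norm of \<open>w\<close>, the norm of \<open>w\<close> is at most twice that of
  \<open>e\<close>. One more application of \<open>P\<close> turns this Euclidean bound into a bound for each entry: by
  Cauchy--Schwarz against a centred column of \<open>P\<close>, whose norm is of order \<open>1 / sqrt N\<close>, no factor
  \<open>sqrt N\<close> is lost. A uniform bound is what the comparison of invariant distributions requires,
  because the vertex weights may concentrate all mass on a few states.
\<close>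

lemma stationary_near_uniform:
  assumes u: "stationary u"
    and col: "\<And>j. j \<in> I \<Longrightarrow> \<bar>(\<Sum>i\<in>I. P i j) - 1\<bar> \<le> \<eta>"
    and col2: "\<And>j. j \<in> I \<Longrightarrow> (\<Sum>i\<in>I. (P i j)\<^sup>2) \<le> \<kappa> / card I"
    and j: "j \<in> I"
  shows "\<bar>real (card I) * u j - 1\<bar> \<le> \<eta> * (1 + 2 * sqrt (\<kappa> + 1))"
proof -
  define n where "n = real (card I)"
  have n: "n > 0" using card_pos by (simp add: n_def)
  have eta0: "0 \<le> \<eta>" using col[OF j] by linarith
  define w where "w i = u i - 1 / n" for i
  define e where "e j = ((\<Sum>i\<in>I. P i j) - 1) / n" for j
  have w_sum: "(\<Sum>i\<in>I. w i) = 0"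
    using u n by (simp add: w_def stationary_def sum_subtractf n_def)
  have w_eq: "w j = e j + step w j" if "j \<in> I" for j
  proof -
    have "step w j = step u j - (\<Sum>i\<in>I. P i j) / n"
      unfolding w_def step_diff by (simp add: step_def sum_divide_distrib)
    then show ?thesis using u that by (simp add: stationary_def e_def w_def diff_divide_distrib)
  qed
  have e_le: "\<bar>e j\<bar> \<le> \<eta> / n" if "j \<in> I" for j
    using col[OF that] n by (simp add: e_def abs_divide divide_right_mono)
  have L2e: "L2_set e I \<le> \<eta> / sqrt n"
  proof -
    have "(\<Sum>i\<in>I. (e i)\<^sup>2) \<le> (\<Sum>i\<in>I. (\<eta> / n)\<^sup>2)"
      using e_le by (intro sum_mono abs_le_square_iff[THEN iffD1]) (metis abs_ge_self order.trans)
    also have "\<dots> = (\<eta> / sqrt n)\<^sup>2"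
      using n by (simp add: n_def[symmetric] power_divide power2_eq_square)
    finally show ?thesis unfolding L2_set_def using eta0 n
      by (metis divide_nonneg_nonneg real_le_lsqrt real_sqrt_ge_zero less_imp_le)
  qed
  have "L2_set w I = L2_set (\<lambda>j. e j + step w j) I"
    by (intro L2_set_cong refl w_eq)
  also have "\<dots> \<le> L2_set e I + L2_set (step w) I"
    by (rule L2_set_triangle_ineq)
  also have "L2_set (step w) I \<le> 1 / 2 * L2_set w I"
  proof -
    have "sqrt (\<Sum>j\<in>I. (step w j)\<^sup>2) \<le> sqrt (1 / 4 * (\<Sum>i\<in>I. (w i)\<^sup>2))"
      by (rule real_sqrt_le_mono[OF step_contracts[OF w_sum]])
    then show ?thesis by (simp add: L2_set_def real_sqrt_mult real_sqrt_divide)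
  qed
  finally have L2w: "L2_set w I \<le> 2 * (\<eta> / sqrt n)" using L2e by linarith
  have kappa: "0 \<le> \<kappa>"
  proof -
    have "0 \<le> \<kappa> / n"
      using order.trans[OF sum_nonneg col2[OF j]] by (simp add: n_def)
    then show ?thesis using n by (simp add: zero_le_divide_iff)
  qed
  have col_pos: "0 \<le> (\<Sum>i\<in>I. P i j)" by (intro sum_nonneg nonneg j)
  have colE: "L2_set (\<lambda>i. P i j - 1 / n) I \<le> sqrt (\<kappa> + 1) / sqrt n"
  proof -
    have "(\<Sum>i\<in>I. (P i j - 1 / n)\<^sup>2) = (\<Sum>i\<in>I. (P i j)\<^sup>2) - 2 / n * (\<Sum>i\<in>I. P i j) + 1 / n"
    proof -
      have "(\<Sum>i\<in>I. (P i j - 1 / n)\<^sup>2) = (\<Sum>i\<in>I. (P i j)\<^sup>2 - 2 / n * P i j + 1 / n\<^sup>2)"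
        by (intro sum.cong refl) (simp add: power2_eq_square algebra_simps)
      also have "\<dots> = (\<Sum>i\<in>I. (P i j)\<^sup>2) - 2 / n * (\<Sum>i\<in>I. P i j) + n / n\<^sup>2"
        by (simp add: sum.distrib sum_subtractf sum_distrib_left n_def)
      also have "n / n\<^sup>2 = 1 / n" using n by (simp add: power2_eq_square)
      finally show ?thesis .
    qed
    also have "\<dots> \<le> \<kappa> / n + 1 / n"
      using col2[OF j] mult_nonneg_nonneg[OF _ col_pos, of "2 / n"] n
      by (simp add: n_def[symmetric])
    finally have "(\<Sum>i\<in>I. (P i j - 1 / n)\<^sup>2) \<le> (\<kappa> + 1) / n" by (simp add: add_divide_distrib)
    then show ?thesis unfolding L2_set_def by (metis real_sqrt_le_mono real_sqrt_divide)
  qed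
  \<comment> \<open>As \<open>w\<close> has mass \<open>0\<close>, the column may be centred.\<close>
  have "step w j = (\<Sum>i\<in>I. w i * (P i j - 1 / n))"
    by (simp add: step_def right_diff_distrib sum_subtractf sum_divide_distrib[symmetric] w_sum)
  then have "\<bar>step w j\<bar> \<le> (\<Sum>i\<in>I. \<bar>w i\<bar> * \<bar>P i j - 1 / n\<bar>)"
    using sum_abs[of "\<lambda>i. w i * (P i j - 1 / n)" I] by (simp add: abs_mult)
  also have "\<dots> \<le> L2_set w I * L2_set (\<lambda>i. P i j - 1 / n) I"
    by (rule L2_set_mult_ineq)
  also have "\<dots> \<le> L2_set w I * (sqrt (\<kappa> + 1) / sqrt n)"
    using colE by (intro mult_left_mono) auto
  also have "\<dots> \<le> 2 * (\<eta> / sqrt n) * (sqrt (\<kappa> + 1) / sqrt n)"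
    using L2w kappa n by (intro mult_right_mono) auto
  also have "\<dots> = \<eta> / n * (2 * sqrt (\<kappa> + 1))"
    using n by simp
  finally have "\<bar>step w j\<bar> \<le> \<eta> / n * (2 * sqrt (\<kappa> + 1))" .
  then have "\<bar>w j\<bar> \<le> \<eta> / n + \<eta> / n * (2 * sqrt (\<kappa> + 1))"
    using w_eq[OF j] e_le[OF j] by linarith
  then have "n * \<bar>w j\<bar> \<le> n * (\<eta> / n + \<eta> / n * (2 * sqrt (\<kappa> + 1)))"
    using n by (intro mult_left_mono) auto
  moreover have "n * \<bar>w j\<bar> = \<bar>n * u j - 1\<bar>"
  proof -
    have "n * \<bar>w j\<bar> = \<bar>n * w j\<bar>" using n by (simp add: abs_mult)
    also have "n * w j = n * u j - 1" using n by (simp add: w_def right_diff_distrib)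
    finally show ?thesis .
  qed
  ultimately show ?thesis using n by (simp add: n_def[symmetric] distrib_left)
qed

end

section \<open>Invariant distributions of balanced arrays\<close>

text \<open>
  The errors of the weights enter twice, through the numerators and through the normalizing sum,
  and each time contribute at most \<open>\<eta>\<close> in total.
\<close>

lemma normalized_weights_close:
  fixes f g :: "'i \<Rightarrow> real"
  assumes F: "0 < (\<Sum>i\<in>I. f i)" and G: "0 < (\<Sum>i\<in>I. g i)"
    and g: "\<And>i. i \<in> I \<Longrightarrow> 0 \<le> g i"
    and close: "\<And>i. i \<in> I \<Longrightarrow> \<bar>g i - f i\<bar> \<le> \<eta> * f i"
  shows "(\<Sum>i\<in>I. \<bar>g i / (\<Sum>k\<in>I. g k) - f i / (\<Sum>k\<in>I. f k)\<bar>) \<le> 2 * \<eta>"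
proof -
  define F G where "F = (\<Sum>i\<in>I. f i)" and "G = (\<Sum>i\<in>I. g i)"
  have pos: "0 < F" "0 < G" using F G by (auto simp: F_def G_def)
  have FG: "\<bar>F - G\<bar> \<le> \<eta> * F"
  proof -
    have "\<bar>F - G\<bar> \<le> (\<Sum>i\<in>I. \<bar>f i - g i\<bar>)"
      unfolding F_def G_def sum_subtractf[symmetric] by (rule sum_abs)
    also have "\<dots> \<le> (\<Sum>i\<in>I. \<eta> * f i)"
      using close by (intro sum_mono) (auto simp: abs_minus_commute)
    finally show ?thesis by (simp add: F_def sum_distrib_left)
  qed
  have "(\<Sum>i\<in>I. \<bar>g i / G - f i / F\<bar>) \<le> (\<Sum>i\<in>I. \<eta> * f i / F + g i * (\<eta> / G))"
  proof (intro sum_mono)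
    fix i assume i: "i \<in> I"
    have "g i / G - f i / F = (g i - f i) / F + g i / G * ((F - G) / F)"
      using pos by (simp add: field_simps)
    also have "\<bar>\<dots>\<bar> \<le> \<bar>g i - f i\<bar> / F + g i / G * (\<bar>F - G\<bar> / F)"
      using pos g[OF i] by (intro order.trans[OF abs_triangle_ineq]) (simp add: abs_mult)
    also have "\<dots> \<le> \<eta> * f i / F + g i / G * (\<eta> * F / F)"
      using pos close[OF i] FG g[OF i] by (intro add_mono divide_right_mono mult_left_mono) auto
    finally show "\<bar>g i / G - f i / F\<bar> \<le> \<eta> * f i / F + g i * (\<eta> / G)"
      using pos by simp
  qed
  also have "\<dots> = \<eta> * F / F + G * (\<eta> / G)"
    by (simp add: sum.distrib F_def G_def sum_distrib_left sum_distrib_right sum_divide_distrib)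
  also have "\<dots> = 2 * \<eta>" using pos by simp
  finally show ?thesis by (simp add: F_def G_def)
qed

definition off_diag :: "(nat \<Rightarrow> nat \<Rightarrow> real) \<Rightarrow> nat \<Rightarrow> nat \<Rightarrow> real" where
  "off_diag x i j = (if i = j then 0 else x i j)"

definition off_row_sum :: "nat \<Rightarrow> (nat \<Rightarrow> nat \<Rightarrow> real) \<Rightarrow> nat \<Rightarrow> real" where
  "off_row_sum n x i = (\<Sum>j=1..n. off_diag x i j)"

text \<open>
  The transition matrix of the embedded jump chain of the generator. The vertex weights cancel
  in it, which is why they do not enter any of the estimates.
\<close>

definition jump_kernel :: "nat \<Rightarrow> (nat \<Rightarrow> nat \<Rightarrow> real) \<Rightarrow> nat \<Rightarrow> nat \<Rightarrow> real" where
  "jump_kernel n x i j = off_diag x i j / off_row_sum n x i"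

lemma row_sum_split:
  assumes "i \<in> {1..n}"
  shows "(\<Sum>k=1..n. x i k) = x i i + off_row_sum n x i"
proof -
  have "off_row_sum n x i = (\<Sum>j\<in>{1..n} - {i}. x i j)"
    unfolding off_row_sum_def off_diag_def by (intro sum.mono_neutral_cong_right) auto
  then show ?thesis using assms by (simp add: sum.remove)
qed

lemma exit_rate_weighted_generator:
  assumes "i \<in> {1..n}" "0 \<le> \<theta> i" "0 \<le> off_row_sum n x i"
  shows "exit_rate (generator n (weighted_matrix \<theta> x)) i = \<theta> i * off_row_sum n x i"
proof -
  have "generator n (weighted_matrix \<theta> x) i i = - (\<theta> i * off_row_sum n x i)"
    using row_sum_split[OF assms(1), of x]
    by (simp add: generator_def weighted_matrix_def algebra_simps flip: sum_distrib_left)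
  then show ?thesis using assms by (simp add: exit_rate_def)
qed

text \<open>
  In terms of \<open>u i = v i * \<theta> i * off_row_sum n x i\<close>, the equations \<open>v Q = 0\<close> say that \<open>u\<close> is
  fixed by the jump kernel.
\<close>

lemma generator_balance:
  assumes j: "j \<in> {1..n}"
  shows "(\<Sum>i=1..n. v i * generator n (weighted_matrix \<theta> x) i j)
    = (\<Sum>i=1..n. v i * \<theta> i * off_diag x i j) - v j * \<theta> j * off_row_sum n x j"
proof -
  have row: "\<theta> j * (\<Sum>k=1..n. x j k) = \<theta> j * x j j + \<theta> j * off_row_sum n x j"
    unfolding row_sum_split[OF j] by (rule distrib_left)
  have "(\<Sum>i=1..n. v i * generator n (weighted_matrix \<theta> x) i j)
      = (\<Sum>i=1..n. v i * \<theta> i * off_diag x i j - (if i = j then v j * \<theta> j * off_row_sum n x j else 0))"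
    by (intro sum.cong refl)
      (use row in \<open>auto simp: generator_def weighted_matrix_def off_diag_def sum_distrib_left
        right_diff_distrib distrib_left mult.assoc\<close>)
  also have "\<dots> = (\<Sum>i=1..n. v i * \<theta> i * off_diag x i j) - v j * \<theta> j * off_row_sum n x j"
    using j by (simp add: sum_subtractf)
  finally show ?thesis .
qed

text \<open>
  The deterministic properties of a typical array that the argument uses. Row and column sums
  bound the error by \<open>\<epsilon>\<close>. Squares along rows and products of two rows serve the Gram condition,
  for which a fixed precision suffices; squares along columns serve the passage to a uniform bound. The numerical constants make the diagonal of the Gram
  matrix and its off-diagonal part contribute at most \<open>1 / 8\<close> each.
\<close>

locale balanced_array =
  fixes n :: nat and m \<epsilon> K :: real and x :: "nat \<Rightarrow> nat \<Rightarrow> real"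
  assumes m: "0 < m" and eps: "0 \<le> \<epsilon>" "\<epsilon> \<le> m / 192" and n_large: "32 * K / m\<^sup>2 \<le> n" "0 < n"
    and x_nonneg: "\<And>i j. i \<in> {1..n} \<Longrightarrow> j \<in> {1..n} \<Longrightarrow> 0 \<le> x i j"
    and row_sums: "\<And>i. i \<in> {1..n} \<Longrightarrow> \<bar>(\<Sum>j=1..n. off_diag x i j) - n * m\<bar> \<le> n * \<epsilon>"
    and col_sums: "\<And>j. j \<in> {1..n} \<Longrightarrow> \<bar>(\<Sum>i=1..n. off_diag x i j) - n * m\<bar> \<le> n * \<epsilon>"
    and row_squares: "\<And>i. i \<in> {1..n} \<Longrightarrow> (\<Sum>j=1..n. (off_diag x i j)\<^sup>2) \<le> K * n"
    and col_squares: "\<And>j. j \<in> {1..n} \<Longrightarrow> (\<Sum>i=1..n. (off_diag x i j)\<^sup>2) \<le> K * n"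
    and row_products: "\<And>i k. i \<in> {1..n} \<Longrightarrow> k \<in> {1..n} \<Longrightarrow> i \<noteq> k \<Longrightarrow>
      \<bar>(\<Sum>j=1..n. off_diag x i j * off_diag x k j) - n * m\<^sup>2\<bar> \<le> n * (m\<^sup>2 / 64)"
begin

abbreviation "r \<equiv> off_row_sum n x"
abbreviation "P \<equiv> jump_kernel n x"
abbreviation "y \<equiv> off_diag x"

lemma y_nonneg: "i \<in> {1..n} \<Longrightarrow> j \<in> {1..n} \<Longrightarrow> 0 \<le> y i j"
  by (simp add: off_diag_def x_nonneg)

lemma r_close: "i \<in> {1..n} \<Longrightarrow> \<bar>r i - n * m\<bar> \<le> n * \<epsilon>"
  using row_sums by (simp add: off_row_sum_def)

lemma n_eps_le: "n * \<epsilon> \<le> n * m / 192"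
  using eps(2) mult_left_mono[of \<epsilon> "m / 192" "real n"] by simp

lemma nm_pos: "0 < n * m"
  using m n_large(2) by simp

lemma r_ge: "i \<in> {1..n} \<Longrightarrow> n * m / 2 \<le> r i"
  using r_close[of i] n_eps_le nm_pos by linarith

lemma r_pos: "i \<in> {1..n} \<Longrightarrow> 0 < r i"
  using r_ge[of i] nm_pos by linarith

lemma squares_scaled:
  assumes "s \<le> K * n"
  shows "s / (n * m / 2)\<^sup>2 \<le> 4 * K / m\<^sup>2 / n"
proof -
  have "s / (n * m / 2)\<^sup>2 \<le> K * n / (n * m / 2)\<^sup>2"
    using assms by (intro divide_right_mono) auto
  also have "\<dots> = 4 * K / m\<^sup>2 / n"
    using n_large(2) m by (simp add: power2_eq_square field_simps)
  finally show ?thesis .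
qed

lemma P_sq_le:
  assumes "i \<in> {1..n}"
  shows "(P i j)\<^sup>2 \<le> (y i j)\<^sup>2 / (n * m / 2)\<^sup>2"
  unfolding jump_kernel_def power_divide[of "y i j"] using r_ge[OF assms] nm_pos r_pos[OF assms]
  by (intro divide_left_mono power_mono mult_pos_pos zero_less_power) auto

lemma P_col_squares:
  assumes j: "j \<in> {1..n}"
  shows "(\<Sum>i=1..n. (P i j)\<^sup>2) \<le> 4 * K / m\<^sup>2 / n"
proof -
  have "(\<Sum>i=1..n. (P i j)\<^sup>2) \<le> (\<Sum>i=1..n. (y i j)\<^sup>2) / (n * m / 2)\<^sup>2"
    unfolding sum_divide_distrib by (intro sum_mono P_sq_le)
  also have "\<dots> \<le> 4 * K / m\<^sup>2 / n"
    by (rule squares_scaled[OF col_squares[OF j]])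
  finally show ?thesis .
qed

lemma P_row_squares:
  assumes i: "i \<in> {1..n}"
  shows "(\<Sum>j=1..n. (P i j)\<^sup>2) \<le> 4 * K / m\<^sup>2 / n"
proof -
  have "(\<Sum>j=1..n. (P i j)\<^sup>2) \<le> (\<Sum>j=1..n. (y i j)\<^sup>2) / (n * m / 2)\<^sup>2"
    unfolding sum_divide_distrib by (intro sum_mono P_sq_le i)
  also have "\<dots> \<le> 4 * K / m\<^sup>2 / n"
    by (rule squares_scaled[OF row_squares[OF i]])
  finally show ?thesis .
qed

lemma P_row: "i \<in> {1..n} \<Longrightarrow> (\<Sum>j=1..n. P i j) = 1"
  using r_pos[of i] by (simp add: jump_kernel_def off_row_sum_def flip: sum_divide_distrib)

lemma inverse_r_close:
  assumes "i \<in> {1..n}"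
  shows "\<bar>n * m / r i - 1\<bar> \<le> 2 * \<epsilon> / m"
proof -
  have "\<bar>n * m / r i - 1\<bar> = \<bar>r i - n * m\<bar> / r i"
    using r_pos[OF assms] by (simp add: abs_divide field_simps abs_minus_commute)
  also have "\<dots> \<le> n * \<epsilon> / (n * m / 2)"
    using r_close[OF assms] r_ge[OF assms] nm_pos eps r_pos[OF assms] by (intro frac_le) auto
  also have "\<dots> = 2 * \<epsilon> / m" using n_large(2) m by (simp add: field_simps)
  finally show ?thesis .
qed

lemma P_col:
  assumes j: "j \<in> {1..n}"
  shows "\<bar>(\<Sum>i=1..n. P i j) - 1\<bar> \<le> 4 * \<epsilon> / m"
proof -
  define c where "c = (\<Sum>i=1..n. y i j) / (n * m)"
  have c: "\<bar>c - 1\<bar> \<le> \<epsilon> / m"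
  proof -
    have "c - 1 = ((\<Sum>i=1..n. y i j) - n * m) / (n * m)"
      using m n_large(2) by (simp add: c_def diff_divide_distrib)
    then have "\<bar>c - 1\<bar> = \<bar>(\<Sum>i=1..n. y i j) - n * m\<bar> / (n * m)"
      using nm_pos by (simp only: abs_divide abs_of_pos)
    also have "\<dots> \<le> n * \<epsilon> / (n * m)"
      using col_sums[OF j] nm_pos by (intro divide_right_mono) auto
    finally show ?thesis using n_large(2) by simp
  qed
  have eps_m: "\<epsilon> / m \<le> 1 / 192" using eps m by (simp add: field_simps)
  have c_nonneg: "0 \<le> c"
    unfolding c_def using nm_pos j by (intro divide_nonneg_nonneg sum_nonneg y_nonneg) auto
  have "(\<Sum>i=1..n. P i j) - c = (\<Sum>i=1..n. y i j / (n * m) * (n * m / r i - 1))"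
    using n_large(2) m unfolding c_def sum_divide_distrib sum_subtractf[symmetric] jump_kernel_def
    by (intro sum.cong refl) (simp add: right_diff_distrib)
  also have "\<bar>\<dots>\<bar> \<le> (\<Sum>i=1..n. y i j / (n * m) * \<bar>n * m / r i - 1\<bar>)"
    using nm_pos m y_nonneg j by (intro order.trans[OF sum_abs]) (simp add: abs_mult abs_divide)
  also have "\<dots> \<le> (\<Sum>i=1..n. y i j / (n * m) * (2 * \<epsilon> / m))"
    using nm_pos y_nonneg j inverse_r_close
    by (intro sum_mono mult_left_mono divide_nonneg_nonneg) auto
  also have "\<dots> = c * (2 * \<epsilon> / m)"
    by (simp add: c_def sum_distrib_right sum_divide_distrib)
  also have "\<dots> \<le> (3 / 2) * (2 * \<epsilon> / m)"
  proof (rule mult_right_mono)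
    show "c \<le> 3 / 2" using c eps_m by linarith
  qed (use eps m in simp)
  also have "\<dots> = 4 * \<epsilon> / m - \<epsilon> / m" by (simp flip: diff_divide_distrib)
  finally show ?thesis using c by linarith
qed

text \<open>
  Both \<open>n\<close> times the inner product of two rows of \<open>y\<close> and the product of their sums are within
  \<open>(n m)\<^sup>2 / 64\<close> of \<open>(n m)\<^sup>2\<close>, and the product of the sums is at least \<open>(n m)\<^sup>2 / 4\<close>.
\<close>

lemma P_gram_off_diag:
  assumes i: "i \<in> {1..n}" and k: "k \<in> {1..n}" and ik: "i \<noteq> k"
  shows "\<bar>(\<Sum>j=1..n. P i j * P k j) - 1 / n\<bar> \<le> 1 / 8 / n"
proof -
  define S where "S = (\<Sum>j=1..n. y i j * y k j)"
  have "(\<Sum>j=1..n. P i j * P k j) = S / (r i * r k)"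
    by (simp add: S_def jump_kernel_def sum_divide_distrib)
  then have "(\<Sum>j=1..n. P i j * P k j) - 1 / n = (n * S - r i * r k) / (n * (r i * r k))"
    using r_pos[OF i] r_pos[OF k] n_large(2) by (simp add: field_simps)
  moreover have "\<bar>n * S - r i * r k\<bar> \<le> (n * m)\<^sup>2 / 32"
  proof -
    have "\<bar>n * (S - n * m\<^sup>2)\<bar> \<le> n * (n * (m\<^sup>2 / 64))"
      using row_products[OF i k ik] unfolding S_def[symmetric] abs_mult by (intro mult_mono) auto
    then have 1: "\<bar>n * S - (n * m)\<^sup>2\<bar> \<le> (n * m)\<^sup>2 / 64"
      by (simp add: power2_eq_square algebra_simps)
    define a b where "a = r i - n * m" and "b = r k - n * m"
    have ab: "\<bar>a\<bar> \<le> n * m / 192" "\<bar>b\<bar> \<le> n * m / 192"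
      using r_close[OF i] r_close[OF k] n_eps_le by (auto simp: a_def b_def)
    have "r i * r k - (n * m)\<^sup>2 = n * m * a + n * m * b + a * b"
      by (simp add: a_def b_def power2_eq_square algebra_simps)
    moreover have "\<bar>n * m * a\<bar> \<le> n * m * (n * m / 192)" "\<bar>n * m * b\<bar> \<le> n * m * (n * m / 192)"
      using mult_left_mono[OF ab(1), of "n * m"] mult_left_mono[OF ab(2), of "n * m"] nm_pos m
      by (simp_all only: abs_mult[of "n * m"] abs_of_pos less_imp_le)
    moreover have "\<bar>a * b\<bar> \<le> n * m * (n * m / 192)"
      unfolding abs_mult using ab nm_pos by (intro mult_mono) auto
    ultimately have "\<bar>r i * r k - (n * m)\<^sup>2\<bar> \<le> 3 * (n * m * (n * m / 192))" by linarith
    then have 2: "\<bar>r i * r k - (n * m)\<^sup>2\<bar> \<le> (n * m)\<^sup>2 / 64"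
      by (simp add: power2_eq_square mult_ac)
    from 1 2 show ?thesis by linarith
  qed
  moreover have "n * ((n * m)\<^sup>2 / 4) \<le> n * (r i * r k)"
  proof -
    have "(n * m / 2) * (n * m / 2) \<le> r i * r k"
      using r_ge[OF i] r_ge[OF k] nm_pos by (intro mult_mono) auto
    then show ?thesis by (intro mult_left_mono) (auto simp: power2_eq_square)
  qed
  ultimately have "\<bar>(\<Sum>j=1..n. P i j * P k j) - 1 / n\<bar> \<le> ((n * m)\<^sup>2 / 32) / (n * ((n * m)\<^sup>2 / 4))"
    using r_pos[OF i] r_pos[OF k] n_large(2) nm_pos m
    by (simp only: abs_divide) (intro frac_le; simp add: abs_mult)
  also have "\<dots> = 1 / 8 / n"
    using m n_large(2) by (simp add: field_simps)
  finally show ?thesis .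
qed

lemma P_gram_row:
  assumes i: "i \<in> {1..n}"
  shows "(\<Sum>k=1..n. \<bar>(\<Sum>j=1..n. P i j * P k j) - 1 / n\<bar>) \<le> 1 / 4"
proof -
  define G where "G k = \<bar>(\<Sum>j=1..n. P i j * P k j) - 1 / n\<bar>" for k
  have "4 * K / m\<^sup>2 / n \<le> 1 / 8"
    using n_large m by (simp add: field_simps)
  \<comment> \<open>By Cauchy--Schwarz a row has squared norm at least \<open>1 / n\<close>, which resolves the absolute value.\<close>
  have diag: "G i \<le> 1 / 8"
  proof -
    define s where "s = (\<Sum>j=1..n. (P i j)\<^sup>2)"
    have "0 \<le> (\<Sum>j=1..n. (P i j - 1 / n)\<^sup>2)" by (intro sum_nonneg) auto
    also have "\<dots> = (\<Sum>j=1..n. (P i j)\<^sup>2 - 2 / n * P i j + 1 / (real n)\<^sup>2)"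
      by (intro sum.cong refl) (simp add: power2_eq_square algebra_simps)
    also have "\<dots> = s - 2 / n * (\<Sum>j=1..n. P i j) + n / (real n)\<^sup>2"
      by (simp add: sum.distrib sum_subtractf sum_distrib_left s_def)
    also have "\<dots> = s - 1 / n"
      using n_large(2) by (simp add: P_row[OF i, simplified] power2_eq_square)
    finally have "0 \<le> s - 1 / n" .
    moreover have "s \<le> 1 / 8"
      using P_row_squares[OF i] \<open>4 * K / m\<^sup>2 / n \<le> 1 / 8\<close> by (simp add: s_def)
    moreover have "G i = \<bar>s - 1 / n\<bar>" by (simp add: G_def s_def power2_eq_square)
    moreover have "0 \<le> 1 / real n" by simp
    ultimately show ?thesis by linarith
  qed
  have "(\<Sum>k=1..n. G k) = G i + (\<Sum>k\<in>{1..n} - {i}. G k)"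
    using i by (simp add: sum.remove)
  also have "(\<Sum>k\<in>{1..n} - {i}. G k) \<le> (\<Sum>k\<in>{1..n} - {i}. 1 / 8 / n)"
    using P_gram_off_diag[OF i] by (intro sum_mono) (auto simp: G_def)
  also have "\<dots> \<le> (\<Sum>k\<in>{1..n}. 1 / 8 / n)"
    by (intro sum_mono2) auto
  also have "\<dots> = 1 / 8" using n_large(2) by simp
  finally show ?thesis using diag by (simp add: G_def)
qed

sublocale near_flat_kernel "{1..n}" P
proof
  show "0 \<le> P i j" if "i \<in> {1..n}" "j \<in> {1..n}" for i j
    using y_nonneg[OF that] r_pos[OF that(1)] by (simp add: jump_kernel_def)
  show "(\<Sum>j\<in>{1..n}. P i j) = 1" if "i \<in> {1..n}" for i
    by (rule P_row[OF that])
  show "(\<Sum>k\<in>{1..n}. \<bar>(\<Sum>j\<in>{1..n}. P i j * P k j) - 1 / real (card {1..n})\<bar>) \<le> 1 / 4"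
    if "i \<in> {1..n}" for i
    unfolding card_atLeastAtMost using P_gram_row[OF that] by simp
  show "{1..n} \<noteq> {}" using n_large(2) by simp
qed simp

text \<open>
  The bound of \<open>stationary_near_uniform\<close> for the constants \<open>\<eta> = 4 \<epsilon> / m\<close> and \<open>\<kappa> = 4 K / m\<^sup>2\<close> of
  \<open>P_col\<close> and \<open>P_col_squares\<close>.
\<close>

definition jump_error :: real where
  "jump_error = 4 * \<epsilon> / m * (1 + 2 * sqrt (4 * K / m\<^sup>2 + 1))"

lemma stationary_close: "stationary u \<Longrightarrow> j \<in> {1..n} \<Longrightarrow> \<bar>real n * u j - 1\<bar> \<le> jump_error"
  unfolding jump_error_def
  using stationary_near_uniform[of u "4 * \<epsilon> / m" "4 * K / m\<^sup>2" j,
      unfolded card_atLeastAtMost add_diff_cancel_right' Suc_eq_plus1] P_col P_col_squares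
  by blast

text \<open>
  Invariant distributions of the generator and stationary vectors of its jump kernel determine each
  other through multiplication by the exit rates and normalization. Both existence and uniqueness,
  which \<open>invariant_dist\<close> presupposes, are inherited from the jump kernel.
\<close>

lemma is_invariant_dist_iff:
  assumes \<theta>: "\<And>i. i \<in> {1..n} \<Longrightarrow> 0 < \<theta> i" and u: "stationary u" "\<And>i. i \<in> {1..n} \<Longrightarrow> 0 \<le> u i"
  defines "g \<equiv> \<lambda>i. u i / (\<theta> i * r i)"
  shows "0 < (\<Sum>i=1..n. g i)" (is ?A)
    and "is_invariant_dist n (generator n (weighted_matrix \<theta> x)) v \<longleftrightarrow>
      v = (\<lambda>i. if i \<in> {1..n} then g i / (\<Sum>k=1..n. g k) else 0)" (is "?L \<longleftrightarrow> ?R")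
proof -
  have q: "0 < \<theta> i * r i" if "i \<in> {1..n}" for i
    using \<theta> r_pos that by simp
  have g_nonneg: "0 \<le> g i" if "i \<in> {1..n}" for i
    using q u(2) that by (simp add: g_def less_imp_le)
  have g_u: "g i * (\<theta> i * r i) = u i" if "i \<in> {1..n}" for i
    using \<theta>[OF that] r_pos[OF that] by (simp add: g_def)
  have balance: "(\<Sum>i=1..n. v i * generator n (weighted_matrix \<theta> x) i j)
      = step (\<lambda>i. v i * (\<theta> i * r i)) j - v j * (\<theta> j * r j)" if "j \<in> {1..n}" for v j
  proof -
    have "v i * \<theta> i * y i j = v i * (\<theta> i * r i) * P i j" if "i \<in> {1..n}" for i
      using r_pos[OF that] by (simp add: jump_kernel_def)
    then have "(\<Sum>i=1..n. v i * \<theta> i * y i j) = step (\<lambda>i. v i * (\<theta> i * r i)) j"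
      unfolding step_def by (intro sum.cong refl)
    then show ?thesis
      unfolding generator_balance[OF that] by (simp add: mult.assoc)
  qed
  show pos: ?A
  proof (rule ccontr)
    assume "\<not> ?A"
    then have "(\<Sum>i=1..n. g i) = 0" using sum_nonneg[of "{1..n}" g] g_nonneg by auto
    then have "\<forall>i\<in>{1..n}. g i = 0" using g_nonneg by (subst (asm) sum_nonneg_eq_0_iff) auto
    then have "\<forall>i\<in>{1..n}. u i = 0" using g_u by fastforce
    then show False using u(1) unfolding stationary_def by simp
  qed
  define G where "G = (\<Sum>k=1..n. g k)"
  have step_scale: "step (\<lambda>i. f i / c) j = step f j / c" for f c j
    unfolding step_def by (simp add: sum_divide_distrib)
  have step_cong: "step f j = step h j" if "\<And>i. i \<in> {1..n} \<Longrightarrow> f i = h i" for f h j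
    using that unfolding step_def by simp
  show "?L \<longleftrightarrow> ?R"
  proof
    assume v: ?R
    have "(\<Sum>i=1..n. v i) = (\<Sum>i=1..n. g i / G)"
      by (intro sum.cong refl) (simp add: v G_def)
    also have "\<dots> = 1" using pos by (simp add: G_def flip: sum_divide_distrib)
    finally have "(\<Sum>i=1..n. v i) = 1" .
    moreover have "(\<Sum>i=1..n. v i * generator n (weighted_matrix \<theta> x) i j) = 0"
      if j: "j \<in> {1..n}" for j
    proof -
      have vq: "v i * (\<theta> i * r i) = u i / G" if "i \<in> {1..n}" for i
        using g_u[OF that] that by (simp add: v G_def)
      have "step (\<lambda>i. v i * (\<theta> i * r i)) j = step u j / G"
        unfolding step_scale[symmetric] by (rule step_cong[OF vq])
      then show ?thesis
        unfolding balance[OF j] vq[OF j] using u(1) j unfolding stationary_def by simp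
    qed
    ultimately show ?L
      using g_nonneg pos by (auto simp: is_invariant_dist_def prob_vector_def v)
  next
    assume v: ?L
    define w where "w i = v i * (\<theta> i * r i)" for i
    define s where "s = (\<Sum>i=1..n. w i)"
    have v0: "0 \<le> v i" if "i \<in> {1..n}" for i
      using v that by (simp add: is_invariant_dist_def prob_vector_def)
    have v_sum: "(\<Sum>i=1..n. v i) = 1"
      using v by (simp add: is_invariant_dist_def prob_vector_def)
    have v_w: "v i = w i / (\<theta> i * r i)" if "i \<in> {1..n}" for i
      using \<theta>[OF that] r_pos[OF that] by (simp add: w_def)
    have w0: "0 \<le> w i" if "i \<in> {1..n}" for i
      using v0 q that by (simp add: w_def less_imp_le)
    have "s \<noteq> 0"
    proof
      assume "s = 0"
      then have "\<forall>i\<in>{1..n}. w i = 0" using w0 unfolding s_def by (subst (asm) sum_nonneg_eq_0_iff) auto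
      then have "\<forall>i\<in>{1..n}. v i = 0" using v_w by simp
      then show False using v_sum by simp
    qed
    have w_fixed: "step w j = w j" if "j \<in> {1..n}" for j
      using balance[OF that, of v] v that by (simp add: is_invariant_dist_def w_def[abs_def])
    have "stationary (\<lambda>i. w i / s)"
      using \<open>s \<noteq> 0\<close> w_fixed unfolding stationary_def step_scale sum_divide_distrib[symmetric]
      by (simp add: s_def)
    then have "w i = s * u i" if "i \<in> {1..n}" for i
      using stationary_unique[OF _ u(1) that] \<open>s \<noteq> 0\<close> by (fastforce simp: field_simps)
    then have v_g: "v i = s * g i" if "i \<in> {1..n}" for i
      using v_w that by (simp add: g_def)
    then have "1 = s * G" using v_sum by (simp add: G_def sum_distrib_left)
    then have "s = 1 / G" by (metis nonzero_eq_divide_eq mult_zero_right zero_neq_one)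
    then show ?R
      using v v_g by (auto simp: is_invariant_dist_def prob_vector_def G_def)
  qed
qed

text \<open>
  The invariant distribution has weights \<open>u i / (\<theta> i * r i)\<close>. The reference weights \<open>1 / w i\<close> are
  compared with them after a free rescaling by \<open>c\<close>, which normalization removes.
\<close>

lemma tv_invariant_dist_recip_dist:
  assumes \<theta>: "\<And>i. i \<in> {1..n} \<Longrightarrow> 0 < \<theta> i" and w: "\<And>i. i \<in> {1..n} \<Longrightarrow> 0 < w i"
    and c: "0 < c"
    and close: "\<And>u i. stationary u \<Longrightarrow> i \<in> {1..n} \<Longrightarrow> \<bar>c * u i * (w i / (\<theta> i * r i)) - 1\<bar> \<le> \<eta>"
  shows "tv_norm n (\<lambda>i. invariant_dist n (generator n (weighted_matrix \<theta> x)) i - recip_dist n w i) \<le> \<eta>"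
proof -
  obtain u where u: "stationary u" "\<And>i. i \<in> {1..n} \<Longrightarrow> 0 \<le> u i"
    using stationary_exists by blast
  define g where "g i = u i / (\<theta> i * r i)" for i
  have g_pos: "0 < (\<Sum>i=1..n. g i)"
    unfolding g_def by (rule is_invariant_dist_iff(1)) (blast intro: \<theta> u)+
  have g_iff: "is_invariant_dist n (generator n (weighted_matrix \<theta> x)) v \<longleftrightarrow>
      v = (\<lambda>i. if i \<in> {1..n} then g i / (\<Sum>k=1..n. g k) else 0)" for v
    unfolding g_def by (rule is_invariant_dist_iff(2)) (blast intro: \<theta> u)+
  have inv_eq: "invariant_dist n (generator n (weighted_matrix \<theta> x))
      = (\<lambda>i. if i \<in> {1..n} then g i / (\<Sum>k=1..n. g k) else 0)"
    unfolding invariant_dist_def by (rule the_equality) (simp_all only: g_iff)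
  have scale: "g i / (\<Sum>k=1..n. g k) = (c * g i) / (\<Sum>k=1..n. c * g k)" for i
    using c by (simp flip: sum_distrib_left)
  have "(\<Sum>i=1..n. \<bar>invariant_dist n (generator n (weighted_matrix \<theta> x)) i - recip_dist n w i\<bar>)
      = (\<Sum>i=1..n. \<bar>(c * g i) / (\<Sum>k=1..n. c * g k) - inverse (w i) / (\<Sum>k=1..n. inverse (w k))\<bar>)"
    by (intro sum.cong refl) (simp only: inv_eq recip_dist_def scale if_True)
  also have "\<dots> \<le> 2 * \<eta>"
  proof (rule normalized_weights_close)
    show "0 < (\<Sum>i=1..n. inverse (w i))"
      using n_large(2) w by (intro sum_pos) auto
    show "0 < (\<Sum>i=1..n. c * g i)"
      using g_pos c by (simp flip: sum_distrib_left)
    fix i assume i: "i \<in> {1..n}"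
    show "0 \<le> c * g i"
      using c u(2)[OF i] \<theta>[OF i] r_pos[OF i] by (simp add: g_def)
    have "c * g i - inverse (w i) = inverse (w i) * (c * u i * (w i / (\<theta> i * r i)) - 1)"
      using w[OF i] by (simp add: g_def field_simps)
    also have "\<bar>\<dots>\<bar> \<le> inverse (w i) * \<eta>"
      using close[OF u(1) i] w[OF i] by (simp add: abs_mult)
    finally show "\<bar>c * g i - inverse (w i)\<bar> \<le> \<eta> * inverse (w i)" by (simp add: mult.commute)
  qed
  finally show ?thesis by (simp add: tv_norm_def)
qed

text \<open>
  With respect to the exit rates \<open>\<theta> i * r i\<close> the weights differ by the factor \<open>n * u i\<close> only.
\<close>

lemma tv_invariant_dist_exit_rate:
  assumes \<theta>: "\<And>i. i \<in> {1..n} \<Longrightarrow> 0 < \<theta> i"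
  defines "Q \<equiv> generator n (weighted_matrix \<theta> x)"
  shows "tv_norm n (\<lambda>i. invariant_dist n Q i - recip_dist n (exit_rate Q) i) \<le> jump_error"
  unfolding Q_def
proof (rule tv_invariant_dist_recip_dist[where c = "real n"])
  have exit: "exit_rate (generator n (weighted_matrix \<theta> x)) i = \<theta> i * r i" if "i \<in> {1..n}" for i
    using \<theta>[OF that] r_pos[OF that] that by (simp add: exit_rate_weighted_generator)
  fix i assume i: "i \<in> {1..n}"
  show "0 < exit_rate (generator n (weighted_matrix \<theta> x)) i"
    using \<theta>[OF i] r_pos[OF i] by (simp add: exit[OF i])
  fix u assume "stationary u"
  then show "\<bar>real n * u i * (exit_rate (generator n (weighted_matrix \<theta> x)) i / (\<theta> i * r i)) - 1\<bar> \<le> jump_error"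
    using stationary_close[OF _ i] \<theta>[OF i] r_pos[OF i] by (simp add: exit[OF i])
qed (use \<theta> n_large(2) in auto)

text \<open>
  With respect to the vertex weights \<open>\<theta> i\<close> there is the additional factor \<open>n * m / r i\<close>, which is
  near \<open>1\<close> by concentration of the row sums.
\<close>

lemma tv_invariant_dist_weights:
  assumes \<theta>: "\<And>i. i \<in> {1..n} \<Longrightarrow> 0 < \<theta> i"
  defines "Q \<equiv> generator n (weighted_matrix \<theta> x)"
  shows "tv_norm n (\<lambda>i. invariant_dist n Q i - recip_dist n \<theta> i) \<le> 2 * jump_error + 2 * \<epsilon> / m"
  unfolding Q_def
proof (rule tv_invariant_dist_recip_dist[where c = "real n * (real n * m)"])
  fix u i assume u: "stationary u" and i: "i \<in> {1..n}"
  define s t where "s = real n * u i - 1" and "t = n * m / r i - 1"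
  have s: "\<bar>s\<bar> \<le> jump_error" using stationary_close[OF u i] by (simp add: s_def)
  have t: "\<bar>t\<bar> \<le> 2 * \<epsilon> / m" using inverse_r_close[OF i] by (simp add: t_def)
  have "2 * \<epsilon> / m \<le> 1" using eps m by (simp add: field_simps)
  then have "\<bar>s * t\<bar> \<le> jump_error * 1"
    unfolding abs_mult using s t by (intro mult_mono) auto
  moreover have "real n * (n * m) * u i * (\<theta> i / (\<theta> i * r i)) - 1 = s + t + s * t"
  proof -
    have "\<theta> i \<noteq> 0" using \<theta>[OF i] by simp
    then have "real n * (n * m) * u i * (\<theta> i / (\<theta> i * r i)) = (s + 1) * (t + 1)"
      by (simp add: s_def t_def)
    then show ?thesis by (simp add: algebra_simps)
  qed
  ultimately show "\<bar>real n * (n * m) * u i * (\<theta> i / (\<theta> i * r i)) - 1\<bar> \<le> 2 * jump_error + 2 * \<epsilon> / m"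
    using s t by linarith
qed (use \<theta> n_large(2) nm_pos in auto)

end

section \<open>Simultaneous concentration of many sums\<close>

lemma exp_le_quadratic:
  fixes x :: real
  assumes "\<bar>x\<bar> \<le> 1"
  shows "exp x \<le> 1 + x + x\<^sup>2"
proof (cases "0 \<le> x")
  case True
  then show ?thesis using exp_bound[of x] assms by simp
next
  case False
  have "0 \<le> (- x) ^ 3" using False by simp
  \<comment> \<open>The product on the right is \<open>1 - x ^ 3\<close>.\<close>
  then have "1 \<le> (1 + x + x\<^sup>2) * (1 + (- x))"
    by (simp add: power2_eq_square power3_eq_cube algebra_simps)
  also have "\<dots> \<le> (1 + x + x\<^sup>2) * exp (- x)"
  proof (rule mult_left_mono)
    show "1 + - x \<le> exp (- x)" by (rule exp_ge_add_one_self)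
    show "0 \<le> 1 + x + x\<^sup>2" using assms by (auto simp: abs_le_iff add_nonneg_nonneg)
  qed
  finally show ?thesis by (simp add: exp_minus field_simps)
qed

context prob_space
begin

lemma integrable_bounded:
  fixes Z :: "'a \<Rightarrow> real"
  assumes "Z \<in> borel_measurable M" "\<And>\<omega>. \<bar>Z \<omega>\<bar> \<le> B"
  shows "integrable M Z"
  using assms by (intro integrable_const_bound[of _ B]) auto

lemma exp_moment_bound:
  fixes Z :: "'a \<Rightarrow> real" and l B V :: real
  assumes Z[measurable]: "Z \<in> borel_measurable M" and B: "\<And>\<omega>. \<bar>Z \<omega>\<bar> \<le> B"
    and l: "0 < l" "l * B \<le> 1" and V: "expectation (\<lambda>\<omega>. (Z \<omega>)\<^sup>2) \<le> V"
  shows "expectation (\<lambda>\<omega>. exp (l * Z \<omega>)) \<le> exp (l * expectation Z + l\<^sup>2 * V)"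
proof -
  have small: "\<bar>l * Z \<omega>\<bar> \<le> 1" for \<omega>
    using order.trans[OF mult_left_mono[OF B, of l \<omega>] l(2)] l(1) by (simp add: abs_mult)
  have int: "integrable M Z" by (rule integrable_bounded[OF Z B])
  have int2: "integrable M (\<lambda>\<omega>. (Z \<omega>)\<^sup>2)"
    using power_mono[OF B abs_ge_zero, where n = 2] by (intro integrable_bounded[of _ "B\<^sup>2"]) auto
  have "expectation (\<lambda>\<omega>. exp (l * Z \<omega>)) \<le> expectation (\<lambda>\<omega>. 1 + l * Z \<omega> + l\<^sup>2 * (Z \<omega>)\<^sup>2)"
  proof (rule integral_mono)
    show "integrable M (\<lambda>\<omega>. exp (l * Z \<omega>))"
    proof (rule integrable_bounded[of _ "exp 1"])
      show "\<bar>exp (l * Z \<omega>)\<bar> \<le> exp 1" for \<omega>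
        using small[of \<omega>] by (simp add: abs_le_iff)
    qed measurable
    show "integrable M (\<lambda>\<omega>. 1 + l * Z \<omega> + l\<^sup>2 * (Z \<omega>)\<^sup>2)" using int int2 by simp
    show "exp (l * Z \<omega>) \<le> 1 + l * Z \<omega> + l\<^sup>2 * (Z \<omega>)\<^sup>2" for \<omega>
      using exp_le_quadratic[OF small[of \<omega>]] by (simp add: power_mult_distrib)
  qed
  also have "\<dots> = 1 + (l * expectation Z + l\<^sup>2 * expectation (\<lambda>\<omega>. (Z \<omega>)\<^sup>2))"
    using int int2 by (simp add: prob_space)
  also have "\<dots> \<le> exp (l * expectation Z + l\<^sup>2 * expectation (\<lambda>\<omega>. (Z \<omega>)\<^sup>2))"
    by (rule exp_ge_add_one_self)
  also have "\<dots> \<le> exp (l * expectation Z + l\<^sup>2 * V)"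
    using V by (simp add: mult_left_mono)
  finally show ?thesis .
qed

text \<open>
  A Bernstein bound without centring: if \<open>l * B \<le> 1\<close>, the exponential moments are controlled by
  second moments alone. In the applications \<open>B\<close> grows with \<open>n\<close> while the second moments stay
  bounded, where a bound in terms of \<open>B\<close> only, such as Hoeffding's, would be too weak.
\<close>

lemma bernstein_upper:
  fixes Z :: "'i \<Rightarrow> 'a \<Rightarrow> real" and l t B V \<mu> :: real
  assumes J: "finite J" and indep: "indep_vars (\<lambda>_. borel) Z J"
    and B: "\<And>j \<omega>. j \<in> J \<Longrightarrow> \<bar>Z j \<omega>\<bar> \<le> B"
    and l: "0 < l" "l * B \<le> 1"
    and mean: "\<And>j. j \<in> J \<Longrightarrow> expectation (Z j) = \<mu>"
    and V: "\<And>j. j \<in> J \<Longrightarrow> expectation (\<lambda>\<omega>. (Z j \<omega>)\<^sup>2) \<le> V"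
  shows "prob {\<omega>\<in>space M. t \<le> (\<Sum>j\<in>J. Z j \<omega>) - card J * \<mu>} \<le> exp (- (l * t) + card J * (l\<^sup>2 * V))"
proof -
  have Z[measurable]: "Z j \<in> borel_measurable M" if "j \<in> J" for j
    using indep that by (auto simp: indep_vars_def)
  define W where "W j \<omega> = exp (l * Z j \<omega>)" for j \<omega>
  have indepW: "indep_vars (\<lambda>_. borel) W J"
    unfolding W_def by (rule indep_vars_compose2[OF indep]) measurable
  have W_int: "integrable M (W j)" if "j \<in> J" for j
    unfolding W_def
  proof (rule integrable_bounded[of _ "exp (l * B)"])
    show "\<bar>exp (l * Z j \<omega>)\<bar> \<le> exp (l * B)" for \<omega>
      using B[OF that, of \<omega>] l by (simp add: abs_le_iff)
  qed (use that in measurable)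
  define c where "c = exp (l * (t + card J * \<mu>))"
  have "{\<omega>\<in>space M. t \<le> (\<Sum>j\<in>J. Z j \<omega>) - card J * \<mu>} = {\<omega>\<in>space M. c \<le> (\<Prod>j\<in>J. W j \<omega>)}"
  proof -
    have "c \<le> (\<Prod>j\<in>J. W j \<omega>) \<longleftrightarrow> t \<le> (\<Sum>j\<in>J. Z j \<omega>) - card J * \<mu>" for \<omega>
    proof -
      have "c \<le> (\<Prod>j\<in>J. W j \<omega>) \<longleftrightarrow> l * (t + card J * \<mu>) \<le> l * (\<Sum>j\<in>J. Z j \<omega>)"
        unfolding c_def W_def exp_sum[OF J, symmetric] sum_distrib_left by (rule exp_le_cancel_iff)
      also have "\<dots> \<longleftrightarrow> t + card J * \<mu> \<le> (\<Sum>j\<in>J. Z j \<omega>)"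
        using l(1) by (rule mult_le_cancel_left_pos)
      finally show ?thesis by linarith
    qed
    then show ?thesis by blast
  qed
  also have "prob \<dots> \<le> expectation (\<lambda>\<omega>. \<Prod>j\<in>J. W j \<omega>) / c"
  proof (rule integral_Markov_inequality_measure[where A = "{}"])
    show "integrable M (\<lambda>\<omega>. \<Prod>j\<in>J. W j \<omega>)"
      by (rule indep_vars_integrable[OF J indepW W_int])
    show "AE \<omega> in M. 0 \<le> (\<Prod>j\<in>J. W j \<omega>)" by (simp add: W_def prod_nonneg)
  qed (auto simp: c_def)
  also have "expectation (\<lambda>\<omega>. \<Prod>j\<in>J. W j \<omega>) = (\<Prod>j\<in>J. expectation (W j))"
    by (rule indep_vars_lebesgue_integral[OF J indepW W_int])
  also have "\<dots> \<le> (\<Prod>j\<in>J. exp (l * \<mu> + l\<^sup>2 * V))"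
  proof (rule prod_mono)
    fix j assume j: "j \<in> J"
    have "expectation (W j) \<le> exp (l * expectation (Z j) + l\<^sup>2 * V)"
      unfolding W_def by (rule exp_moment_bound[OF Z[OF j] B[OF j] l V[OF j]])
    moreover have "0 \<le> expectation (W j)"
      unfolding W_def by (rule Bochner_Integration.integral_nonneg) simp
    ultimately show "0 \<le> expectation (W j) \<and> expectation (W j) \<le> exp (l * \<mu> + l\<^sup>2 * V)"
      by (simp add: mean[OF j])
  qed
  also have "\<dots> = exp (card J * (l * \<mu> + l\<^sup>2 * V))"
    by (simp add: exp_of_nat_mult)
  finally have "prob {\<omega>\<in>space M. t \<le> (\<Sum>j\<in>J. Z j \<omega>) - card J * \<mu>}
      \<le> exp (card J * (l * \<mu> + l\<^sup>2 * V)) / c"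
    by (simp add: c_def divide_right_mono)
  also have "\<dots> = exp (- (l * t) + card J * (l\<^sup>2 * V))"
    unfolding c_def exp_diff[symmetric] by (simp add: algebra_simps)
  finally show ?thesis .
qed

lemma bernstein_two_sided:
  fixes Z :: "'i \<Rightarrow> 'a \<Rightarrow> real" and l t B V \<mu> :: real
  assumes J: "finite J" and indep: "indep_vars (\<lambda>_. borel) Z J"
    and B: "\<And>j \<omega>. j \<in> J \<Longrightarrow> \<bar>Z j \<omega>\<bar> \<le> B"
    and l: "0 < l" "l * B \<le> 1"
    and mean: "\<And>j. j \<in> J \<Longrightarrow> expectation (Z j) = \<mu>"
    and V: "\<And>j. j \<in> J \<Longrightarrow> expectation (\<lambda>\<omega>. (Z j \<omega>)\<^sup>2) \<le> V"
  shows "prob {\<omega>\<in>space M. t \<le> \<bar>(\<Sum>j\<in>J. Z j \<omega>) - card J * \<mu>\<bar>}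
    \<le> 2 * exp (- (l * t) + card J * (l\<^sup>2 * V))"
proof -
  have Z[measurable]: "Z j \<in> borel_measurable M" if "j \<in> J" for j
    using indep that by (auto simp: indep_vars_def)
  have S[measurable]: "(\<lambda>\<omega>. \<Sum>j\<in>J. Z j \<omega>) \<in> borel_measurable M"
    by (intro borel_measurable_sum Z)
  let ?U = "{\<omega>\<in>space M. t \<le> (\<Sum>j\<in>J. Z j \<omega>) - card J * \<mu>}"
  let ?L = "{\<omega>\<in>space M. t \<le> (\<Sum>j\<in>J. - Z j \<omega>) - card J * (- \<mu>)}"
  have L: "prob ?L \<le> exp (- (l * t) + card J * (l\<^sup>2 * V))"
  proof (rule bernstein_upper[where B = B])
    show "indep_vars (\<lambda>_. borel) (\<lambda>j \<omega>. - Z j \<omega>) J"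
      by (rule indep_vars_compose2[OF indep]) measurable
  qed (use J B l mean V in auto)
  have "prob {\<omega>\<in>space M. t \<le> \<bar>(\<Sum>j\<in>J. Z j \<omega>) - card J * \<mu>\<bar>} \<le> prob (?U \<union> ?L)"
    by (rule finite_measure_mono) (auto simp: sum_negf abs_le_iff)
  also have "\<dots> \<le> prob ?U + prob ?L"
    by (rule measure_Un_le) (simp_all add: sum_negf)
  also have "\<dots> \<le> exp (- (l * t) + card J * (l\<^sup>2 * V)) + exp (- (l * t) + card J * (l\<^sup>2 * V))"
    by (intro add_mono L bernstein_upper[OF J indep B l mean V])
  finally show ?thesis by simp
qed

text \<open>
  The Borel--Cantelli lemma for families of events whose number grows with \<open>n\<close>.
\<close>

lemma AE_eventually_none:
  fixes E :: "nat \<Rightarrow> 's \<Rightarrow> 'a set" and f :: "nat \<Rightarrow> real"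
  assumes S: "\<And>n. finite (S n)" and E: "\<And>n s. s \<in> S n \<Longrightarrow> E n s \<in> events"
    and bound: "\<And>n s. s \<in> S n \<Longrightarrow> prob (E n s) \<le> f n"
    and sum: "summable (\<lambda>n. card (S n) * f n)"
  shows "AE \<omega> in M. \<forall>\<^sub>F n in sequentially. \<forall>s\<in>S n. \<omega> \<notin> E n s"
proof -
  define A where "A n = (\<Union>s\<in>S n. E n s)" for n
  have A: "A n \<in> events" for n unfolding A_def using S E by auto
  have le: "prob (A n) \<le> card (S n) * f n" for n
  proof -
    have "prob (A n) \<le> (\<Sum>s\<in>S n. prob (E n s))"
      unfolding A_def using S E by (intro measure_UNION_le) auto
    also have "\<dots> \<le> (\<Sum>s\<in>S n. f n)" by (intro sum_mono bound)
    finally show ?thesis by simp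
  qed
  have "AE \<omega> in M. \<forall>\<^sub>F n in sequentially. \<omega> \<in> space M - A n"
  proof (rule borel_cantelli_AE1[OF A])
    show "summable (\<lambda>n. prob (A n))"
      by (rule summable_comparison_test'[OF sum, of 0]) (use le in auto)
  qed (simp add: emeasure_eq_measure)
  then show ?thesis by eventually_elim (auto simp: A_def elim: eventually_mono)
qed

text \<open>
  The assumption \<open>sum\<close> makes the union bound over quadratically many sums summable. The index \<open>s\<close> stands for
  a row or for a pair of rows.
\<close>

lemma AE_eventually_concentrated:
  fixes Z :: "nat \<Rightarrow> 's \<Rightarrow> nat \<Rightarrow> 'a \<Rightarrow> real" and l t B \<mu> :: "nat \<Rightarrow> real" and V :: real
  assumes S: "\<And>n. finite (S n)" "\<And>n. card (S n) \<le> n\<^sup>2"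
    and J: "\<And>n s. s \<in> S n \<Longrightarrow> J s n \<subseteq> {1..n}"
    and indep: "\<And>n s. s \<in> S n \<Longrightarrow> indep_vars (\<lambda>_. borel) (Z n s) (J s n)"
    and B: "\<And>n s j \<omega>. s \<in> S n \<Longrightarrow> j \<in> J s n \<Longrightarrow> \<bar>Z n s j \<omega>\<bar> \<le> B n"
    and l: "\<And>n. 0 < n \<Longrightarrow> 0 < l n" "\<And>n. 0 < n \<Longrightarrow> l n * B n \<le> 1"
    and mean: "\<And>n s j. s \<in> S n \<Longrightarrow> j \<in> J s n \<Longrightarrow> expectation (Z n s j) = \<mu> n"
    and V: "\<And>n s j. s \<in> S n \<Longrightarrow> j \<in> J s n \<Longrightarrow> expectation (\<lambda>\<omega>. (Z n s j \<omega>)\<^sup>2) \<le> V"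
    and V0: "0 \<le> V"
    and sum: "(\<lambda>n. real n ^ 2 * (2 * exp (- (l n * t n) + n * ((l n)\<^sup>2 * V)))) \<in> O(\<lambda>n. real n powr - 2)"
  shows "AE \<omega> in M. \<forall>\<^sub>F n in sequentially. \<forall>s\<in>S n. \<bar>(\<Sum>j\<in>J s n. Z n s j \<omega>) - card (J s n) * \<mu> n\<bar> \<le> t n"
proof -
  define f where "f n = 2 * exp (- (l n * t n) + n * ((l n)\<^sup>2 * V))" for n
  define E where "E n s = {\<omega>\<in>space M. t n \<le> \<bar>(\<Sum>j\<in>J s n. Z n s j \<omega>) - card (J s n) * \<mu> n\<bar>}" for n s
  have finJ: "finite (J s n)" if "s \<in> S n" for s n
    using J[OF that] by (rule finite_subset) simp
  have Z[measurable]: "Z n s j \<in> borel_measurable M" if "s \<in> S n" "j \<in> J s n" for n s j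
    using indep that by (auto simp: indep_vars_def)
  have "AE \<omega> in M. \<forall>\<^sub>F n in sequentially. \<forall>s\<in>S n. \<omega> \<notin> E n s"
  proof (rule AE_eventually_none)
    show "E n s \<in> events" if "s \<in> S n" for n s
    proof -
      have [measurable]: "(\<lambda>\<omega>. \<Sum>j\<in>J s n. Z n s j \<omega>) \<in> borel_measurable M"
        using that by (intro borel_measurable_sum Z)
      show ?thesis unfolding E_def by measurable
    qed
    show "prob (E n s) \<le> f n" if s: "s \<in> S n" for n s
    proof (cases "n = 0")
      case True
      then show ?thesis using S(2)[of n] S(1)[of n] s by auto
    next
      case False
      have "prob (E n s) \<le> 2 * exp (- (l n * t n) + card (J s n) * ((l n)\<^sup>2 * V))"
        unfolding E_def using False
        by (intro bernstein_two_sided[OF finJ[OF s] indep[OF s] B[OF s] l mean[OF s] V[OF s]]) auto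
      also have "\<dots> \<le> f n"
        unfolding f_def using V0 card_mono[OF _ J[OF s]] by (auto intro!: mult_right_mono)
      finally show ?thesis .
    qed
    have "summable (\<lambda>n. real n ^ 2 * f n)"
    proof (rule summable_comparison_test_bigo)
      show "summable (\<lambda>n. norm (real n powr - 2))"
        by (simp add: summable_real_powr_iff)
      show "(\<lambda>n. real n ^ 2 * f n) \<in> O(\<lambda>n. real n powr - 2)"
        using sum by (simp add: f_def)
    qed
    then show "summable (\<lambda>n. card (S n) * f n)"
    proof (rule summable_comparison_test'[where N = 0])
      fix n
      have "real (card (S n)) \<le> real n ^ 2" using S(2)[of n] by (metis of_nat_le_iff of_nat_power)
      then show "norm (real (card (S n)) * f n) \<le> real n ^ 2 * f n"
        by (simp add: f_def mult_right_mono)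
    qed
  qed (rule S(1))
  moreover have "AE \<omega> in M. \<omega> \<in> space M" by (rule AE_space)
  ultimately show ?thesis
    by eventually_elim (auto simp: E_def elim!: eventually_mono)
qed

end

section \<open>Clipping the entries of a random array\<close>

definition clip :: "real \<Rightarrow> real \<Rightarrow> real" where
  "clip c x = max 0 (min x c)"

lemma clip_measurable [measurable]: "clip c \<in> borel_measurable borel"
  unfolding clip_def[abs_def] by measurable

lemma clip_nonneg: "0 \<le> clip c x"
  by (simp add: clip_def)

lemma clip_le: "0 \<le> c \<Longrightarrow> clip c x \<le> c"
  by (simp add: clip_def)

lemma clip_le_abs: "clip c x \<le> \<bar>x\<bar>"
  by (simp add: clip_def)

lemma clip_eq: "0 \<le> x \<Longrightarrow> x \<le> c \<Longrightarrow> clip c x = x"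
  by (simp add: clip_def)

text \<open>
  For \<open>x > c\<close> the left-hand side is negative, as \<open>(x / c) ^ 3 > 1\<close>. Integrated, the inequality
  bounds the loss of mean under clipping by a fourth moment.
\<close>

lemma clip_defect:
  assumes c: "0 < c" and x: "0 \<le> x"
  shows "x - x ^ 4 / c ^ 3 \<le> clip c x"
proof (cases "x \<le> c")
  case True
  then show ?thesis using assms by (simp add: clip_eq)
next
  case False
  then have "1 \<le> (x / c) ^ 3" using c by (intro one_le_power) simp
  then have "x * 1 \<le> x * (x / c) ^ 3" using x by (intro mult_left_mono)
  then have "x - x ^ 4 / c ^ 3 \<le> 0"
    by (simp add: power_divide power4_eq_xxxx power3_eq_cube mult.assoc)
  then show ?thesis using clip_nonneg order.trans by blast
qed

lemma (in prob_space) indep_vars_groups: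
  fixes X :: "'i \<Rightarrow> 'a \<Rightarrow> real"
  assumes "indep_vars (\<lambda>_. borel) X I" "\<And>j. j \<in> J \<Longrightarrow> K j \<subseteq> I" "disjoint_family_on K J"
    and "\<And>j. j \<in> J \<Longrightarrow> g j \<in> borel_measurable (PiM (K j) (\<lambda>_. borel))"
  shows "indep_vars (\<lambda>_. borel) (\<lambda>j \<omega>. g j (restrict (\<lambda>i. X i \<omega>) (K j))) J"
  by (rule indep_vars_compose2[OF indep_vars_restrict[OF assms(1-3)] assms(4)])

locale iid_array = prob_space M for M :: "'a measure" +
  fixes L :: "real measure" and X :: "nat \<Rightarrow> nat \<Rightarrow> 'a \<Rightarrow> real" and p :: real
  assumes L_prob: "prob_space L" and sets_L: "sets L = sets borel" and L_nonneg: "AE x in L. 0 \<le> x"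
    and indep: "indep_vars (\<lambda>_. borel) (\<lambda>(i, j). X i j) ({1..} \<times> {1..})"
    and distr_X: "\<And>i j. 1 \<le> i \<Longrightarrow> 1 \<le> j \<Longrightarrow> distr M borel (X i j) = L"
    and p: "4 < p" and moment: "integrable L (\<lambda>x. \<bar>x\<bar> powr p)"
begin

sublocale L: prob_space L by (rule L_prob)

lemma X_measurable: "1 \<le> i \<Longrightarrow> 1 \<le> j \<Longrightarrow> X i j \<in> borel_measurable M"
  using indep by (fastforce simp: indep_vars_def)

text \<open>
  Statements about columns are those about rows of the transposed array.
\<close>

lemma transposed: "iid_array M L (\<lambda>i j. X j i) p"
proof
  let ?K = "\<lambda>s. {(snd s, fst s)} :: (nat \<times> nat) set"
  have "indep_vars (\<lambda>_. borel)
      (\<lambda>s \<omega>. (\<lambda>f. f (snd s, fst s)) (restrict (\<lambda>i. (\<lambda>(i, j). X i j) i \<omega>) (?K s))) ({1..} \<times> {1..})"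
    by (rule indep_vars_groups[OF indep]) (auto simp: disjoint_family_on_def)
  then show "indep_vars (\<lambda>_. borel) (\<lambda>(i, j). X j i) ({1..} \<times> {1..})"
    by (simp add: case_prod_beta')
qed (use sets_L L_nonneg distr_X p moment in auto)

lemma borel_L [simp]: "borel_measurable L = borel_measurable borel"
  by (rule measurable_cong_sets[OF sets_L refl])

lemma expectation_X:
  fixes h :: "real \<Rightarrow> real"
  assumes "1 \<le> i" "1 \<le> j" "h \<in> borel_measurable borel"
  shows "expectation (\<lambda>\<omega>. h (X i j \<omega>)) = L.expectation h"
  using integral_distr[OF X_measurable[OF assms(1,2)] assms(3)] distr_X[OF assms(1,2)] by simp

lemma AE_X_nonneg: "AE \<omega> in M. \<forall>i\<ge>1. \<forall>j\<ge>1. 0 \<le> X i j \<omega>"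
proof -
  have "AE \<omega> in M. 0 \<le> X i j \<omega>" if "1 \<le> i" "1 \<le> j" for i j
    using L_nonneg unfolding distr_X[OF that, symmetric] by (rule AE_distrD[OF X_measurable[OF that]])
  then have "AE \<omega> in M. 1 \<le> i \<longrightarrow> 1 \<le> j \<longrightarrow> 0 \<le> X i j \<omega>" for i j by (cases "1 \<le> i \<and> 1 \<le> j") auto
  then show ?thesis by (auto simp: AE_all_countable)
qed

lemma integrable_power: "k \<le> 4 \<Longrightarrow> integrable L (\<lambda>x. x ^ k)"
proof (rule Bochner_Integration.integrable_bound[of L "\<lambda>x. 1 + \<bar>x\<bar> powr p"])
  assume k: "k \<le> 4"
  show "AE x in L. norm (x ^ k) \<le> norm (1 + \<bar>x\<bar> powr p)"
  proof (rule AE_I2)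
    fix x :: real
    show "norm (x ^ k) \<le> norm (1 + \<bar>x\<bar> powr p)"
    proof (cases "\<bar>x\<bar> \<le> 1")
      case True
      then have "\<bar>x\<bar> ^ k \<le> 1" by (intro power_le_one) auto
      then show ?thesis by (simp add: power_abs add_increasing2)
    next
      case False
      then have "\<bar>x\<bar> ^ k = \<bar>x\<bar> powr k" by (simp add: powr_realpow)
      also have "\<dots> \<le> \<bar>x\<bar> powr p" using False k p by (intro powr_mono) auto
      finally show ?thesis by (simp add: power_abs)
    qed
  qed
qed (use moment in auto)

definition mean :: real where "mean = L.expectation (\<lambda>x. x)"
definition m2 :: real where "m2 = L.expectation (\<lambda>x. x ^ 2)"
definition m4 :: real where "m4 = L.expectation (\<lambda>x. x ^ 4)"

lemma m2_nonneg: "0 \<le> m2" and m4_nonneg: "0 \<le> m4"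
  by (auto simp: m2_def m4_def)

lemma mean_nonneg: "0 \<le> mean"
  unfolding mean_def using L_nonneg by (rule integral_nonneg_AE)

lemma mean_pos:
  assumes "L \<noteq> return borel 0"
  shows "0 < mean"
proof (rule ccontr)
  assume "\<not> 0 < mean"
  then have "mean = 0" using mean_nonneg by simp
  then have "AE x in L. x = 0"
    using integral_nonneg_eq_0_iff_AE[of L "\<lambda>x. x"] integrable_power[of 1] L_nonneg
    by (simp add: mean_def)
  then have "L = return L 0" by (rule L.AE_eq_constD)
  then show False using assms return_cong[OF sets_L] by metis
qed

text \<open>
  Entries of the \<open>n\<close>-by-\<open>n\<close> array are clipped at \<open>n powr \<beta>\<close>. By \<open>\<beta> > 2 / p\<close>, all but finitely
  many of the entries \<open>X i j\<close> are below \<open>max i j powr \<beta>\<close>, so that clipping changes nothing in the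
  end. By \<open>\<beta> < 1 / 2\<close>, clipped entries are admissible in the Bernstein bound with \<open>l\<close> of order
  \<open>1 / sqrt n\<close>, and their squares and products with some \<open>l\<close> of larger order than \<open>1 / n\<close>. The
  number below lies between \<open>2 / p\<close> and \<open>1 / 2\<close> because \<open>p > 4\<close>. It also exceeds \<open>1 / 4\<close>, which
  makes the loss \<open>n powr (- 3 * \<beta>)\<close> in the mean smaller than \<open>1 / sqrt n\<close>.
\<close>

definition \<beta> :: real where "\<beta> = 1 / 4 + 1 / p"

lemma \<beta>: "1 / 4 < \<beta>" "\<beta> < 1 / 2" "\<beta> * p = p / 4 + 1"
  using p by (auto simp: \<beta>_def field_simps)

definition clipped :: "nat \<Rightarrow> nat \<Rightarrow> nat \<Rightarrow> 'a \<Rightarrow> real" where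
  "clipped n i j \<omega> = clip (real n powr \<beta>) (X i j \<omega>)"

definition clipped_mean :: "nat \<Rightarrow> real" where
  "clipped_mean n = L.expectation (clip (real n powr \<beta>))"

lemma clipped_nonneg: "0 \<le> clipped n i j \<omega>"
  by (simp add: clipped_def clip_nonneg)

lemma clipped_le: "clipped n i j \<omega> \<le> real n powr \<beta>"
  by (simp add: clipped_def clip_le)

lemma integrable_clip_power: "integrable L (\<lambda>x. clip (real n powr \<beta>) x ^ k)"
proof (rule L.integrable_const_bound[of _ "(real n powr \<beta>) ^ k"])
  show "AE x in L. norm (clip (real n powr \<beta>) x ^ k) \<le> (real n powr \<beta>) ^ k"
    by (intro AE_I2) (simp add: power_mono clip_nonneg clip_le)
qed simp

lemma clip_power_le:
  assumes "k \<le> 4" "even k"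
  shows "L.expectation (\<lambda>x. clip (real n powr \<beta>) x ^ k) \<le> L.expectation (\<lambda>x. x ^ k)"
proof (rule integral_mono[OF integrable_clip_power integrable_power[OF assms(1)]])
  show "clip (real n powr \<beta>) x ^ k \<le> x ^ k" for x
    using power_mono[OF clip_le_abs clip_nonneg, of _ x k] assms(2) by (simp add: power_even_abs)
qed

lemma clipped_mean_nonneg: "0 \<le> clipped_mean n"
  unfolding clipped_mean_def by (intro Bochner_Integration.integral_nonneg clip_nonneg)

lemma clipped_mean_le: "clipped_mean n \<le> mean"
  unfolding clipped_mean_def mean_def
proof (rule integral_mono_AE)
  show "AE x in L. clip (real n powr \<beta>) x \<le> x"
    using L_nonneg by eventually_elim (simp add: clip_def)
qed (use integrable_clip_power[of n 1] integrable_power[of 1] in auto)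

lemma mean_minus_clipped_mean:
  assumes "0 < n"
  shows "mean - clipped_mean n \<le> m4 * real n powr (- (3 * \<beta>))"
proof -
  define c where "c = real n powr \<beta>"
  have c: "0 < c" using assms by (simp add: c_def)
  have "mean - m4 / c ^ 3 = L.expectation (\<lambda>x. x - x ^ 4 / c ^ 3)"
    using integrable_power[of 1] integrable_power[of 4] by (simp add: mean_def m4_def)
  also have "\<dots> \<le> clipped_mean n"
    unfolding clipped_mean_def c_def[symmetric]
  proof (rule integral_mono_AE)
    show "AE x in L. x - x ^ 4 / c ^ 3 \<le> clip c x"
      using L_nonneg by eventually_elim (rule clip_defect[OF c])
  qed (use integrable_clip_power[of n 1] integrable_power[of 1] integrable_power[of 4] in
      \<open>auto simp: c_def\<close>)
  finally have "mean - clipped_mean n \<le> m4 / c ^ 3" by simp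
  also have "\<dots> = m4 * real n powr (- (3 * \<beta>))"
  proof -
    have "c ^ 3 = real n powr (3 * \<beta>)"
      using assms by (simp add: c_def powr_powr powr_realpow[symmetric] mult.commute)
    then show ?thesis by (simp add: powr_minus divide_inverse)
  qed
  finally show ?thesis .
qed

lemma expectation_clipped_power:
  assumes "1 \<le> i" "1 \<le> j"
  shows "expectation (\<lambda>\<omega>. clipped n i j \<omega> ^ k) = L.expectation (\<lambda>x. clip (real n powr \<beta>) x ^ k)"
  unfolding clipped_def using assms by (rule expectation_X[where h = "\<lambda>x. clip _ x ^ k"]) measurable

lemma expectation_clipped:
  assumes "1 \<le> i" "1 \<le> j"
  shows "expectation (clipped n i j) = clipped_mean n"
  using expectation_clipped_power[OF assms, of n 1] by (simp add: clipped_mean_def)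

lemma expectation_clipped_product:
  assumes "1 \<le> i" "1 \<le> k" "1 \<le> j" "i \<noteq> k"
  shows "expectation (\<lambda>\<omega>. clipped n i j \<omega> ^ d * clipped n k j \<omega> ^ d)
    = L.expectation (\<lambda>x. clip (real n powr \<beta>) x ^ d) * L.expectation (\<lambda>x. clip (real n powr \<beta>) x ^ d)"
proof -
  let ?h = "\<lambda>x. clip (real n powr \<beta>) x ^ d"
  let ?Z = "\<lambda>s \<omega>. ?h ((\<lambda>(i, j). X i j) s \<omega>)"
  let ?S = "{(i, j), (k, j)}"
  have "indep_vars (\<lambda>_. borel) (\<lambda>(i, j). X i j) ?S"
    by (rule indep_vars_subset[OF indep]) (use assms in auto)
  then have ind: "indep_vars (\<lambda>_. borel) ?Z ?S"
    by (rule indep_vars_compose2) measurable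
  have int: "integrable M (?Z s)" if "s \<in> ?S" for s
  proof (rule integrable_bounded[of _ "(real n powr \<beta>) ^ d"])
    show "?Z s \<in> borel_measurable M"
      using ind that by (auto simp: indep_vars_def)
    show "\<bar>?Z s \<omega>\<bar> \<le> (real n powr \<beta>) ^ d" for \<omega>
      by (simp add: power_mono clip_nonneg clip_le power_abs)
  qed
  have "expectation (\<lambda>\<omega>. \<Prod>s\<in>?S. ?Z s \<omega>) = (\<Prod>s\<in>?S. expectation (?Z s))"
    by (rule indep_vars_lebesgue_integral[OF _ ind int]) auto
  then show ?thesis
    using assms expectation_clipped_power[of i j n d] expectation_clipped_power[of k j n d]
    by (simp add: clipped_def)
qed

lemma indep_clipped_pairs:
  fixes g :: "real \<times> real \<Rightarrow> real"
  assumes "1 \<le> i" "1 \<le> k" "J \<subseteq> {1..}" and g: "g \<in> borel_measurable (borel \<Otimes>\<^sub>M borel)"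
  shows "indep_vars (\<lambda>_. borel) (\<lambda>j \<omega>. g (clipped n i j \<omega>, clipped n k j \<omega>)) J"
proof -
  let ?K = "\<lambda>j. {(i, j), (k, j)}"
  let ?g = "\<lambda>j f. g (clip (real n powr \<beta>) (f (i, j)), clip (real n powr \<beta>) (f (k, j)))"
  have "indep_vars (\<lambda>_. borel) (\<lambda>j \<omega>. ?g j (restrict (\<lambda>s. (\<lambda>(i, j). X i j) s \<omega>) (?K j))) J"
  proof (rule indep_vars_groups[OF indep])
    show "?g j \<in> borel_measurable (PiM (?K j) (\<lambda>_. borel))" for j
      by (rule measurable_compose[OF _ g]) measurable
  qed (use assms in \<open>auto simp: disjoint_family_on_def\<close>)
  then show ?thesis by (simp add: clipped_def)
qed

lemma prob_X_large:
  assumes "1 \<le> i" "1 \<le> j" "0 < c"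
  shows "prob {\<omega>\<in>space M. c \<le> X i j \<omega>} \<le> L.expectation (\<lambda>x. \<bar>x\<bar> powr p) * c powr - p"
proof -
  note [measurable] = X_measurable[OF assms(1,2)]
  have int: "integrable M (\<lambda>\<omega>. \<bar>X i j \<omega>\<bar> powr p)"
    using moment distr_X[OF assms(1,2)]
    by (subst (asm) distr_X[OF assms(1,2), symmetric], subst (asm) integrable_distr_eq) auto
  have "prob {\<omega>\<in>space M. c \<le> X i j \<omega>} \<le> prob {\<omega>\<in>space M. c powr p \<le> \<bar>X i j \<omega>\<bar> powr p}"
    using assms(3) p by (intro finite_measure_mono) (auto intro!: powr_mono2)
  also have "\<dots> \<le> expectation (\<lambda>\<omega>. \<bar>X i j \<omega>\<bar> powr p) / c powr p"
    using assms(3) by (intro integral_Markov_inequality_measure[where A = "{}"] int) auto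
  also have "expectation (\<lambda>\<omega>. \<bar>X i j \<omega>\<bar> powr p) = L.expectation (\<lambda>x. \<bar>x\<bar> powr p)"
    using assms(1,2) by (rule expectation_X) measurable
  finally show ?thesis by (simp add: powr_minus divide_inverse)
qed

text \<open>
  Step \<open>k\<close> concerns only the \<open>2 k - 1\<close> entries that are new in the \<open>k\<close>-by-\<open>k\<close> array. A union
  bound over all \<open>k\<^sup>2\<close> entries would be summable only for \<open>\<beta> * p > 3\<close>; the one over new entries is
  summable for \<open>\<beta> * p > 2\<close>.
\<close>

lemma AE_eventually_new_entries_small:
  "AE \<omega> in M. \<forall>\<^sub>F k in sequentially. \<forall>s\<in>{1..k} \<times> {k} \<union> {k} \<times> {1..k}. X (fst s) (snd s) \<omega> < real k powr \<beta>"
proof -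
  define S where "S k = {1..k} \<times> {k} \<union> {k} \<times> {1..k}" for k :: nat
  define C where "C = L.expectation (\<lambda>x. \<bar>x\<bar> powr p)"
  have C0: "0 \<le> C" by (simp add: C_def)
  have "AE \<omega> in M. \<forall>\<^sub>F k in sequentially. \<forall>s\<in>S k.
      \<omega> \<notin> {\<omega>\<in>space M. real k powr \<beta> \<le> X (fst s) (snd s) \<omega>}"
  proof (rule AE_eventually_none)
    fix k :: nat and s assume "s \<in> S k"
    then have s: "1 \<le> fst s" "1 \<le> snd s" "1 \<le> k" by (auto simp: S_def)
    note [measurable] = X_measurable[OF s(1,2)]
    show "{\<omega>\<in>space M. real k powr \<beta> \<le> X (fst s) (snd s) \<omega>} \<in> events" by measurable
    have "prob {\<omega>\<in>space M. real k powr \<beta> \<le> X (fst s) (snd s) \<omega>} \<le> C * (real k powr \<beta>) powr - p"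
      unfolding C_def using s by (intro prob_X_large) auto
    also have "\<dots> = C * real k powr - (p / 4 + 1)"
      using \<beta>(3) by (simp add: powr_powr)
    finally show "prob {\<omega>\<in>space M. real k powr \<beta> \<le> X (fst s) (snd s) \<omega>} \<le> C * real k powr - (p / 4 + 1)" .
  next
    show "summable (\<lambda>k. card (S k) * (C * real k powr - (p / 4 + 1)))"
    proof (rule summable_comparison_test'[where N = 0])
      show "summable (\<lambda>k. 2 * C * real k powr - (p / 4))"
        using p by (intro summable_mult) (simp add: summable_real_powr_iff)
      fix k :: nat
      have "card (S k) \<le> card ({1..k} \<times> {k}) + card ({k} \<times> {1..k})"
        unfolding S_def by (rule card_Un_le)
      then have "card (S k) \<le> 2 * k" by simp
      then have "real (card (S k)) \<le> 2 * real k" by linarith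
      then have "norm (card (S k) * (C * real k powr - (p / 4 + 1))) \<le> 2 * real k * (C * real k powr - (p / 4 + 1))"
        using C0 by (simp add: abs_mult mult_right_mono)
      also have "\<dots> = 2 * C * (real k powr 1 * real k powr - (p / 4 + 1))" by simp
      also have "\<dots> = 2 * C * real k powr - (p / 4)" unfolding powr_add[symmetric] by simp
      finally show "norm (card (S k) * (C * real k powr - (p / 4 + 1))) \<le> 2 * C * real k powr - (p / 4)" .
    qed
  qed (auto simp: S_def)
  moreover have "AE \<omega> in M. \<omega> \<in> space M" by (rule AE_space)
  ultimately show ?thesis
    unfolding S_def[symmetric] by eventually_elim (simp add: not_le)
qed

text \<open>
  The finitely many exceptional entries are bounded by a constant, which \<open>n powr \<beta>\<close> exceeds
  eventually.
\<close>

lemma AE_eventually_clipped_eq: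
  "AE \<omega> in M. \<forall>\<^sub>F n in sequentially. \<forall>i\<in>{1..n}. \<forall>j\<in>{1..n}. clipped n i j \<omega> = X i j \<omega>"
  using AE_eventually_new_entries_small AE_X_nonneg
proof eventually_elim
  case (elim \<omega>)
  then obtain k0 where k0: "\<And>k s. k0 \<le> k \<Longrightarrow> s \<in> {1..k} \<times> {k} \<union> {k} \<times> {1..k} \<Longrightarrow>
      X (fst s) (snd s) \<omega> < real k powr \<beta>"
    unfolding eventually_sequentially by blast
  define C where "C = (\<Sum>s\<in>{1..k0} \<times> {1..k0}. \<bar>X (fst s) (snd s) \<omega>\<bar>)"
  have "\<forall>\<^sub>F n in sequentially. C \<le> real n powr \<beta>"
    using \<beta>(1) by real_asymp
  then show ?case
  proof eventually_elim
    case (elim n)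
    have "X i j \<omega> \<le> real n powr \<beta>" if ij: "i \<in> {1..n}" "j \<in> {1..n}" for i j
    proof (cases "max i j \<le> k0")
      case True
      then have "\<bar>X (fst (i, j)) (snd (i, j)) \<omega>\<bar> \<le> C"
        unfolding C_def using ij by (intro member_le_sum) auto
      then show ?thesis using elim by simp
    next
      case False
      then have "X i j \<omega> < real (max i j) powr \<beta>"
        using ij k0[of "max i j" "(i, j)"] by (auto simp: max_def split: if_splits)
      also have "\<dots> \<le> real n powr \<beta>" using ij \<beta>(1) by (intro powr_mono2) auto
      finally show ?thesis by simp
    qed
    then show ?case
      using \<open>\<forall>i\<ge>1. \<forall>j\<ge>1. 0 \<le> X i j \<omega>\<close> by (simp add: clipped_def clip_eq)
  qed
qed

end

section \<open>Random arrays are eventually balanced\<close>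

lemma sum_off_diag:
  assumes "i \<in> {1..n}" "\<And>j. j \<in> {1..n} - {i} \<Longrightarrow> f (off_diag x i j) = g j" "f 0 = 0"
  shows "(\<Sum>j=1..n. f (off_diag x i j)) = (\<Sum>j\<in>{1..n} - {i}. g j)"
  using assms by (intro sum.mono_neutral_cong_right) (auto simp: off_diag_def)

lemma row_indices_subset: "{1..n} - I \<subseteq> {1..}" for n :: nat
  by auto

lemma of_nat_powr_le_1:
  assumes "s \<le> (0::real)" "0 < n"
  shows "real n powr s \<le> 1"
  using powr_mono[of s 0 "real n"] assms by simp

context iid_array
begin

text \<open>
  Bernstein's bound with \<open>l = 1 / sqrt n\<close> gives failure probabilities of order
  \<open>exp (- n powr (1 / 2 - a) / 2)\<close>. One half of the admissible error is reserved for the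
  fluctuations, the other for the difference between \<open>n * mean\<close> and the sum of the \<open>n - 1\<close> clipped
  means.
\<close>

lemma AE_row_sums:
  fixes a :: real
  assumes a: "a < 1 / 2"
  shows "AE \<omega> in M. \<forall>\<^sub>F n in sequentially. \<forall>i\<in>{1..n}.
    \<bar>(\<Sum>j=1..n. off_diag (\<lambda>i j. X i j \<omega>) i j) - n * mean\<bar> \<le> n * real n powr - a"
proof -
  have "AE \<omega> in M. \<forall>\<^sub>F n in sequentially. \<forall>i\<in>{1..n}.
    \<bar>(\<Sum>j\<in>{1..n} - {i}. clipped n i j \<omega>) - card ({1..n} - {i}) * clipped_mean n\<bar> \<le> real n powr (1 - a) / 2"
  proof (rule AE_eventually_concentrated[where B = "\<lambda>n. real n powr \<beta>" and l = "\<lambda>n. real n powr - (1 / 2)"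
        and V = m2])
    show "indep_vars (\<lambda>_. borel) (clipped n i) ({1..n} - {i})" if "i \<in> {1..n}" for n i
      using indep_clipped_pairs[of i i "{1..n} - {i}" fst n] that row_indices_subset by simp
    show "expectation (clipped n i j) = clipped_mean n" if "i \<in> {1..n}" "j \<in> {1..n} - {i}" for n i j
      using that by (intro expectation_clipped) auto
    show "expectation (\<lambda>\<omega>. (clipped n i j \<omega>)\<^sup>2) \<le> m2" if "i \<in> {1..n}" "j \<in> {1..n} - {i}" for n i j
      using that clip_power_le[of 2 n] by (simp add: expectation_clipped_power m2_def)
    show "\<bar>clipped n i j \<omega>\<bar> \<le> real n powr \<beta>" for n i j \<omega>
      using clipped_nonneg clipped_le by simp
    show "real n powr - (1 / 2) * real n powr \<beta> \<le> 1" if "0 < n" for n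
      unfolding powr_add[symmetric] using \<beta> that by (intro of_nat_powr_le_1) auto
    show "(\<lambda>n. real n ^ 2 * (2 * exp (- (real n powr - (1 / 2) * (real n powr (1 - a) / 2))
        + n * ((real n powr - (1 / 2))\<^sup>2 * m2)))) \<in> O(\<lambda>n. real n powr - 2)"
      using a by real_asymp
  qed (use m2_nonneg in \<open>auto simp: power2_eq_square\<close>)
  then show ?thesis
    using AE_eventually_clipped_eq
  proof eventually_elim
    case (elim \<omega>)
    have "\<forall>\<^sub>F n in sequentially. m4 * real n powr (- (3 * \<beta>)) \<le> real n powr - a / 4"
    proof -
      define d where "d = 3 * \<beta>"
      have "a < d" using a \<beta> by (auto simp: d_def)
      then show ?thesis unfolding d_def[symmetric] using m4_nonneg by real_asymp
    qed
    moreover have "\<forall>\<^sub>F n in sequentially. mean \<le> real n powr (1 - a) / 4"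
      using a by real_asymp
    ultimately show ?case using elim eventually_gt_at_top[of 0]
    proof eventually_elim
      case (elim n)
      show ?case
      proof
        fix i assume i: "i \<in> {1..n}"
        have card: "real (card ({1..n} - {i})) = real n - 1"
          using i \<open>0 < n\<close> by (simp add: of_nat_diff)
        have S: "(\<Sum>j=1..n. off_diag (\<lambda>i j. X i j \<omega>) i j) = (\<Sum>j\<in>{1..n} - {i}. clipped n i j \<omega>)"
          using elim i by (intro sum_off_diag[where f = "\<lambda>x. x"]) (auto simp: off_diag_def)
        have 1: "\<bar>(\<Sum>j\<in>{1..n} - {i}. clipped n i j \<omega>) - (real n - 1) * clipped_mean n\<bar>
            \<le> real n powr (1 - a) / 2"
          using elim(3) i unfolding card[symmetric] by blast
        have n_powr: "real n powr (1 - a) = real n * real n powr - a"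
          using \<open>0 < n\<close> powr_add[of "real n" 1 "- a"] by simp
        have "real n * mean - (real n - 1) * clipped_mean n
            = clipped_mean n + real n * (mean - clipped_mean n)" by (simp add: algebra_simps)
        moreover have "real n * (mean - clipped_mean n) \<le> real n * (real n powr - a / 4)"
          using mean_minus_clipped_mean[OF \<open>0 < n\<close>] elim(1) by (intro mult_left_mono) auto
        moreover have "0 \<le> real n * (mean - clipped_mean n)"
          using clipped_mean_le by simp
        ultimately have 2: "\<bar>(real n - 1) * clipped_mean n - real n * mean\<bar> \<le> real n powr (1 - a) / 2"
          using elim(2) clipped_mean_le[of n] clipped_mean_nonneg[of n] n_powr by linarith
        from 1 2 n_powr show "\<bar>(\<Sum>j=1..n. off_diag (\<lambda>i j. X i j \<omega>) i j) - n * mean\<bar> \<le> n * real n powr - a"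
          unfolding S by linarith
      qed
    qed
  qed
qed

text \<open>
  Squares and products of clipped entries are at most \<open>n powr (2 * \<beta>)\<close>. With the reciprocal of this
  as \<open>l\<close>, deviations of order \<open>n\<close> have probabilities of order \<open>exp (- c * n powr (1 - 2 * \<beta>))\<close> with
  a constant \<open>c > 0\<close>.
\<close>

lemma AE_row_squares:
  "AE \<omega> in M. \<forall>\<^sub>F n in sequentially. \<forall>i\<in>{1..n}.
    (\<Sum>j=1..n. (off_diag (\<lambda>i j. X i j \<omega>) i j)\<^sup>2) \<le> (m2 + 1) * n"
proof -
  define \<mu> where "\<mu> n = L.expectation (\<lambda>x. clip (real n powr \<beta>) x ^ 2)" for n :: nat
  have \<mu>_le: "\<mu> n \<le> m2" for n
    unfolding \<mu>_def m2_def by (rule clip_power_le) auto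
  have \<mu>_nonneg: "0 \<le> \<mu> n" for n by (simp add: \<mu>_def)
  have "AE \<omega> in M. \<forall>\<^sub>F n in sequentially. \<forall>i\<in>{1..n}.
    \<bar>(\<Sum>j\<in>{1..n} - {i}. (clipped n i j \<omega>)\<^sup>2) - card ({1..n} - {i}) * \<mu> n\<bar> \<le> real n"
  proof (rule AE_eventually_concentrated[where B = "\<lambda>n. real n powr (2 * \<beta>)"
        and l = "\<lambda>n. real n powr - (2 * \<beta>)" and V = m4])
    show "indep_vars (\<lambda>_. borel) (\<lambda>j \<omega>. (clipped n i j \<omega>)\<^sup>2) ({1..n} - {i})" if "i \<in> {1..n}" for n i
      using indep_clipped_pairs[of i i "{1..n} - {i}" "\<lambda>s. (fst s)\<^sup>2" n] that row_indices_subset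
      by simp
    show "expectation (\<lambda>\<omega>. (clipped n i j \<omega>)\<^sup>2) = \<mu> n" if "i \<in> {1..n}" "j \<in> {1..n} - {i}" for n i j
      using that by (simp add: \<mu>_def expectation_clipped_power)
    show "expectation (\<lambda>\<omega>. ((clipped n i j \<omega>)\<^sup>2)\<^sup>2) \<le> m4" if "i \<in> {1..n}" "j \<in> {1..n} - {i}" for n i j
      using that clip_power_le[of 4 n] by (simp add: expectation_clipped_power m4_def flip: power_mult)
    show "\<bar>(clipped n i j \<omega>)\<^sup>2\<bar> \<le> real n powr (2 * \<beta>)" for n i j \<omega>
    proof -
      have "(clipped n i j \<omega>)\<^sup>2 \<le> (real n powr \<beta>)\<^sup>2"
        by (intro power_mono clipped_le clipped_nonneg)
      then show ?thesis by (simp add: power2_eq_square flip: powr_add)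
    qed
    show "real n powr - (2 * \<beta>) * real n powr (2 * \<beta>) \<le> 1" if "0 < n" for n
      unfolding powr_add[symmetric] by simp
    show "(\<lambda>n. real n ^ 2 * (2 * exp (- (real n powr - (2 * \<beta>) * real n)
        + n * ((real n powr - (2 * \<beta>))\<^sup>2 * m4)))) \<in> O(\<lambda>n. real n powr - 2)"
    proof -
      define d where "d = 2 * \<beta>"
      have "0 < d" "d < 1" using \<beta> by (auto simp: d_def)
      then show ?thesis unfolding d_def[symmetric] by real_asymp
    qed
  qed (use m4_nonneg in \<open>auto simp: power2_eq_square\<close>)
  then show ?thesis
    using AE_eventually_clipped_eq
  proof eventually_elim
    case (elim \<omega>)
    then show ?case
    proof eventually_elim
      case (elim n)
      show ?case
      proof
        fix i assume i: "i \<in> {1..n}"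
        have S: "(\<Sum>j=1..n. (off_diag (\<lambda>i j. X i j \<omega>) i j)\<^sup>2) = (\<Sum>j\<in>{1..n} - {i}. (clipped n i j \<omega>)\<^sup>2)"
          using elim i by (intro sum_off_diag) (auto simp: off_diag_def)
        have "card ({1..n} - {i}) * \<mu> n \<le> real n * m2"
          using \<mu>_le \<mu>_nonneg i by (intro mult_mono) auto
        moreover have "\<bar>(\<Sum>j\<in>{1..n} - {i}. (clipped n i j \<omega>)\<^sup>2) - card ({1..n} - {i}) * \<mu> n\<bar> \<le> real n"
          using elim(1) i by blast
        moreover have "(m2 + 1) * real n = real n * m2 + real n" by (simp add: algebra_simps)
        ultimately show "(\<Sum>j=1..n. (off_diag (\<lambda>i j. X i j \<omega>) i j)\<^sup>2) \<le> (m2 + 1) * n"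
          unfolding S by linarith
      qed
    qed
  qed
qed

text \<open>
  For fixed distinct rows, the products are independent as \<open>j\<close> varies, since each of them uses a
  different column. Their mean is the square of the clipped mean.
\<close>

lemma AE_row_products:
  fixes \<delta> :: real
  assumes \<delta>: "0 < \<delta>"
  shows "AE \<omega> in M. \<forall>\<^sub>F n in sequentially. \<forall>i\<in>{1..n}. \<forall>k\<in>{1..n} - {i}.
    \<bar>(\<Sum>j=1..n. off_diag (\<lambda>i j. X i j \<omega>) i j * off_diag (\<lambda>i j. X i j \<omega>) k j) - n * mean\<^sup>2\<bar> \<le> n * \<delta>"
proof -
  define S where "S n = {s \<in> {1..n} \<times> {1..n}. fst s \<noteq> snd s}" for n :: nat
  define J where "J s n = {1..n} - {fst s, snd s}" for s :: "nat \<times> nat" and n :: nat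
  define Z where "Z n s j \<omega> = clipped n (fst s) j \<omega> * clipped n (snd s) j \<omega>" for n s j \<omega>
  have S: "1 \<le> fst s" "1 \<le> snd s" "fst s \<noteq> snd s" if "s \<in> S n" for s n
    using that by (auto simp: S_def)
  have J: "1 \<le> j" if "j \<in> J s n" for s j n
    using that by (auto simp: J_def)
  have "AE \<omega> in M. \<forall>\<^sub>F n in sequentially. \<forall>s\<in>S n.
    \<bar>(\<Sum>j\<in>J s n. Z n s j \<omega>) - card (J s n) * (clipped_mean n)\<^sup>2\<bar> \<le> real n * \<delta> / 2"
  proof (rule AE_eventually_concentrated[where B = "\<lambda>n. real n powr (2 * \<beta>)"
        and l = "\<lambda>n. real n powr - (2 * \<beta>)" and V = "m2\<^sup>2"])
    show "finite (S n)" for n by (simp add: S_def)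
    have "card (S n) \<le> card ({1..n} \<times> {1..n})" for n
      unfolding S_def by (rule card_mono) auto
    then show "card (S n) \<le> n\<^sup>2" for n by (simp add: power2_eq_square)
    show "J s n \<subseteq> {1..n}" for s n by (auto simp: J_def)
    show "indep_vars (\<lambda>_. borel) (Z n s) (J s n)" if "s \<in> S n" for n s
      using indep_clipped_pairs[of "fst s" "snd s" "J s n" "\<lambda>s. fst s * snd s" n] S[OF that] row_indices_subset
      by (simp add: Z_def[abs_def] J_def)
    show "expectation (Z n s j) = (clipped_mean n)\<^sup>2" if "s \<in> S n" "j \<in> J s n" for n s j
      using expectation_clipped_product[of "fst s" "snd s" j n 1] S[OF that(1)] J[OF that(2)]
      by (simp add: Z_def[abs_def] clipped_mean_def power2_eq_square)
    show "expectation (\<lambda>\<omega>. (Z n s j \<omega>)\<^sup>2) \<le> m2\<^sup>2" if "s \<in> S n" "j \<in> J s n" for n s j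
    proof -
      have "L.expectation (\<lambda>x. clip (real n powr \<beta>) x ^ 2) \<le> m2"
        unfolding m2_def by (rule clip_power_le) auto
      then show ?thesis
        using expectation_clipped_product[of "fst s" "snd s" j n 2] S[OF that(1)] J[OF that(2)]
        by (auto simp: Z_def power_mult_distrib power2_eq_square[of m2] intro!: mult_mono m2_nonneg)
    qed
    show "\<bar>Z n s j \<omega>\<bar> \<le> real n powr (2 * \<beta>)" for n s j \<omega>
    proof -
      have "\<bar>Z n s j \<omega>\<bar> \<le> real n powr \<beta> * real n powr \<beta>"
        unfolding Z_def abs_mult using clipped_nonneg clipped_le by (intro mult_mono) auto
      then show ?thesis by (simp flip: powr_add)
    qed
    show "real n powr - (2 * \<beta>) * real n powr (2 * \<beta>) \<le> 1" if "0 < n" for n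
      unfolding powr_add[symmetric] by simp
    show "(\<lambda>n. real n ^ 2 * (2 * exp (- (real n powr - (2 * \<beta>) * (real n * \<delta> / 2))
        + n * ((real n powr - (2 * \<beta>))\<^sup>2 * m2\<^sup>2)))) \<in> O(\<lambda>n. real n powr - 2)"
    proof -
      define d where "d = 2 * \<beta>"
      have "0 < d" "d < 1" using \<beta> by (auto simp: d_def)
      then show ?thesis unfolding d_def[symmetric] using \<delta> by real_asymp
    qed
  qed auto
  then show ?thesis
    using AE_eventually_clipped_eq
  proof eventually_elim
    case (elim \<omega>)
    have "\<forall>\<^sub>F n in sequentially. 2 * mean * (m4 * real n powr (- (3 * \<beta>))) \<le> \<delta> / 4"
    proof -
      define d where "d = 3 * \<beta>"
      have "0 < d" using \<beta> by (auto simp: d_def)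
      then show ?thesis unfolding d_def[symmetric] using \<delta> by real_asymp
    qed
    moreover have "\<forall>\<^sub>F n in sequentially. 2 * mean\<^sup>2 \<le> real n * \<delta> / 4"
      using \<delta> by real_asymp
    ultimately show ?case using elim eventually_gt_at_top[of 0]
    proof eventually_elim
      case (elim n)
      show ?case
      proof (intro ballI)
        fix i k assume "i \<in> {1..n}" "k \<in> {1..n} - {i}"
        then have ik: "i \<in> {1..n}" "k \<in> {1..n}" "i \<noteq> k" and s: "(i, k) \<in> S n"
          by (auto simp: S_def)
        have "card (J (i, k) n) = n - 2"
          using ik unfolding J_def by (subst card_Diff_subset) auto
        moreover have "2 \<le> n" using ik by auto
        ultimately have card: "real (card (J (i, k) n)) = real n - 2" by (simp add: of_nat_diff)
        have sum_eq: "(\<Sum>j=1..n. off_diag (\<lambda>i j. X i j \<omega>) i j * off_diag (\<lambda>i j. X i j \<omega>) k j)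
            = (\<Sum>j\<in>J (i, k) n. Z n (i, k) j \<omega>)"
          using elim ik unfolding J_def Z_def
          by (intro sum.mono_neutral_cong_right) (auto simp: off_diag_def)
        have 1: "\<bar>(\<Sum>j\<in>J (i, k) n. Z n (i, k) j \<omega>) - (real n - 2) * (clipped_mean n)\<^sup>2\<bar> \<le> real n * \<delta> / 2"
          using elim(3) s unfolding card[symmetric] by blast
        define c where "c = clipped_mean n"
        have c: "0 \<le> c" "c \<le> mean" "mean - c \<le> m4 * real n powr (- (3 * \<beta>))"
          using clipped_mean_nonneg clipped_mean_le mean_minus_clipped_mean \<open>0 < n\<close> by (auto simp: c_def)
        have "c\<^sup>2 \<le> mean\<^sup>2" using c by (intro power_mono) auto
        have "mean\<^sup>2 - c\<^sup>2 = (mean + c) * (mean - c)" by (simp add: power2_eq_square algebra_simps)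
        also have "\<dots> \<le> 2 * mean * (m4 * real n powr (- (3 * \<beta>)))"
          using c m4_nonneg by (intro mult_mono) auto
        finally have "real n * (mean\<^sup>2 - c\<^sup>2) \<le> real n * (\<delta> / 4)"
          using elim(1) by (intro mult_left_mono) auto
        moreover have "0 \<le> real n * (mean\<^sup>2 - c\<^sup>2)" using \<open>c\<^sup>2 \<le> mean\<^sup>2\<close> by simp
        moreover have "real n * mean\<^sup>2 - (real n - 2) * c\<^sup>2 = 2 * c\<^sup>2 + real n * (mean\<^sup>2 - c\<^sup>2)"
          by (simp add: algebra_simps)
        moreover have "0 \<le> c\<^sup>2" by simp
        ultimately have "\<bar>(real n - 2) * c\<^sup>2 - real n * mean\<^sup>2\<bar> \<le> real n * \<delta> / 2"
          using elim(2) \<open>c\<^sup>2 \<le> mean\<^sup>2\<close> by linarith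
        with 1 show "\<bar>(\<Sum>j=1..n. off_diag (\<lambda>i j. X i j \<omega>) i j * off_diag (\<lambda>i j. X i j \<omega>) k j)
            - n * mean\<^sup>2\<bar> \<le> n * \<delta>"
          unfolding sum_eq c_def by linarith
      qed
    qed
  qed
qed

lemma AE_eventually_balanced:
  fixes a :: real
  assumes a: "0 < a" "a < 1 / 2" and L: "L \<noteq> return borel 0"
  shows "AE \<omega> in M. \<forall>\<^sub>F n in sequentially.
    balanced_array n mean (real n powr - a) (m2 + 1) (\<lambda>i j. X i j \<omega>)"
proof -
  interpret T: iid_array M L "\<lambda>i j. X j i" p by (rule transposed)
  have pos: "0 < mean" by (rule mean_pos[OF L])
  have "0 < mean\<^sup>2 / 64" using pos by simp
  have swap: "off_diag (\<lambda>i j. X j i \<omega>) i j = off_diag (\<lambda>i j. X i j \<omega>) j i" for \<omega> i j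
    by (simp add: off_diag_def)
  note cols = T.AE_row_sums[OF a(2), unfolded swap] T.AE_row_squares[unfolded swap]
  from AE_row_sums[OF a(2)] AE_row_squares cols AE_row_products[OF \<open>0 < mean\<^sup>2 / 64\<close>] AE_X_nonneg
  show ?thesis
  proof eventually_elim
    case (elim \<omega>)
    have "\<forall>\<^sub>F n in sequentially. real n powr - a \<le> mean / 192"
      using a pos by real_asymp
    moreover have "\<forall>\<^sub>F n in sequentially. 32 * (m2 + 1) / mean\<^sup>2 \<le> real n"
      by real_asymp
    ultimately show ?case
      using elim(1-5) eventually_gt_at_top[of 0]
    proof eventually_elim
      case (elim n)
      show ?case
      proof
        show "\<bar>(\<Sum>j=1..n. off_diag (\<lambda>i j. X i j \<omega>) i j * off_diag (\<lambda>i j. X i j \<omega>) k j) - n * mean\<^sup>2\<bar>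
            \<le> n * (mean\<^sup>2 / 64)" if "i \<in> {1..n}" "k \<in> {1..n}" "i \<noteq> k" for i k
          using elim that by blast
        show "0 \<le> X i j \<omega>" if "i \<in> {1..n}" "j \<in> {1..n}" for i j
          using \<open>\<forall>i\<ge>1. \<forall>j\<ge>1. 0 \<le> X i j \<omega>\<close> that by simp
        show "0 \<le> real n powr - a" by simp
      qed (use elim pos in blast)+
    qed
  qed
qed

end

section \<open>The invariant distribution of the random generator\<close>

theorem theorem1p2:
  fixes M :: "'a measure"
    and L :: "real measure"
    and X :: "nat \<Rightarrow> nat \<Rightarrow> 'a \<Rightarrow> real"
    and \<theta> :: "nat \<Rightarrow> 'a \<Rightarrow> real"
    and p a :: real
    and Q :: "nat \<Rightarrow> 'a \<Rightarrow> nat \<Rightarrow> nat \<Rightarrow> real"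
  assumes "prob_space M"
    and "prob_space L" and "sets L = sets borel"
    and "AE x in L. 0 \<le> x"
    and "\<And>c. L \<noteq> return borel c"
    and "prob_space.indep_vars M (\<lambda>_. borel) (\<lambda>(i, j). X i j) ({1..} \<times> {1..})"
    and "\<And>i j. 1 \<le> i \<Longrightarrow> 1 \<le> j \<Longrightarrow> distr M borel (X i j) = L"
    and "\<And>i. 1 \<le> i \<Longrightarrow> \<theta> i \<in> borel_measurable M"
    and "\<And>i \<omega>. 1 \<le> i \<Longrightarrow> \<omega> \<in> space M \<Longrightarrow> 0 < \<theta> i \<omega>"
    and "4 < p" and "integrable L (\<lambda>x. \<bar>x\<bar> powr p)"
    and "a < min (1 / 2) (1 - 4 / p)"
  defines "Q \<equiv> \<lambda>n \<omega>. generator n (weighted_matrix (\<lambda>i. \<theta> i \<omega>) (\<lambda>i j. X i j \<omega>))"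
  shows "(AE \<omega> in M.
            (\<lambda>n. tv_norm n (\<lambda>i. invariant_dist n (Q n \<omega>) i - recip_dist n (exit_rate (Q n \<omega>)) i))
              \<in> O(\<lambda>n. real n powr (- a)))
       \<and> (AE \<omega> in M.
            (\<lambda>n. tv_norm n (\<lambda>i. invariant_dist n (Q n \<omega>) i - recip_dist n (\<lambda>i. \<theta> i \<omega>) i))
              \<in> O(\<lambda>n. real n powr (- a)))"
proof -
  interpret iid_array M L X p
    using assms(1-4,6,7,10,11) by (simp add: iid_array_def iid_array_axioms_def)
  \<comment> \<open>The errors in a balanced array must tend to \<open>0\<close>, so a positive exponent is taken.\<close>
  define b where "b = max a (1 / 4)"
  have b: "0 < b" "b < 1 / 2" "a \<le> b" using assms(12) by (auto simp: b_def)
  define D where "D = 4 / mean * (1 + 2 * sqrt (4 * (m2 + 1) / mean\<^sup>2 + 1))"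
  have bounds: "AE \<omega> in M. \<forall>\<^sub>F n in sequentially.
      tv_norm n (\<lambda>i. invariant_dist n (Q n \<omega>) i - recip_dist n (exit_rate (Q n \<omega>)) i) \<le> D * real n powr - b \<and>
      tv_norm n (\<lambda>i. invariant_dist n (Q n \<omega>) i - recip_dist n (\<lambda>i. \<theta> i \<omega>) i) \<le> (2 * D + 2 / mean) * real n powr - b"
    using AE_eventually_balanced[OF b(1,2) assms(5)] AE_space
  proof eventually_elim
    case (elim \<omega>)
    from elim(1) show ?case
    proof eventually_elim
      case (elim n)
      then interpret balanced_array n mean "real n powr - b" "m2 + 1" "\<lambda>i j. X i j \<omega>" .
      have \<theta>: "0 < \<theta> i \<omega>" if "i \<in> {1..n}" for i
        using assms(9) \<open>\<omega> \<in> space M\<close> that by simp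
      have "jump_error = D * real n powr - b" by (simp add: jump_error_def D_def)
      then show ?case
        using tv_invariant_dist_exit_rate[of "\<lambda>i. \<theta> i \<omega>"] tv_invariant_dist_weights[of "\<lambda>i. \<theta> i \<omega>"] \<theta>
        by (simp add: Q_def distrib_right)
    qed
  qed
  have bigo: "(\<lambda>n. tv_norm n (f n)) \<in> O(\<lambda>n. real n powr - a)"
    if "\<forall>\<^sub>F n in sequentially. tv_norm n (f n) \<le> C * real n powr - b" for f :: "nat \<Rightarrow> nat \<Rightarrow> real" and C
  proof -
    have "(\<lambda>n. tv_norm n (f n)) \<in> O(\<lambda>n. real n powr - b)"
    proof (rule bigoI)
      show "\<forall>\<^sub>F n in sequentially. norm (tv_norm n (f n)) \<le> C * norm (real n powr - b)"
        using that by eventually_elim (simp add: tv_norm_def sum_nonneg)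
    qed
    also have "(\<lambda>n. real n powr - b) \<in> O(\<lambda>n. real n powr - a)"
    proof (rule bigoI)
      show "\<forall>\<^sub>F n in sequentially. norm (real n powr - b) \<le> 1 * norm (real n powr - a)"
        using eventually_ge_at_top[of 1] by eventually_elim (use b(3) in \<open>simp add: powr_mono\<close>)
    qed
    finally show ?thesis .
  qed
  show ?thesis
  proof (rule conjI; rule AE_mp[OF bounds]; rule AE_I2; rule impI)
    fix \<omega>
    assume *: "\<forall>\<^sub>F n in sequentially.
      tv_norm n (\<lambda>i. invariant_dist n (Q n \<omega>) i - recip_dist n (exit_rate (Q n \<omega>)) i) \<le> D * real n powr - b \<and>
      tv_norm n (\<lambda>i. invariant_dist n (Q n \<omega>) i - recip_dist n (\<lambda>i. \<theta> i \<omega>) i) \<le> (2 * D + 2 / mean) * real n powr - b"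
    show "(\<lambda>n. tv_norm n (\<lambda>i. invariant_dist n (Q n \<omega>) i - recip_dist n (exit_rate (Q n \<omega>)) i))
        \<in> O(\<lambda>n. real n powr (- a))"
      by (rule bigo[OF eventually_mono[OF *]]) blast
    show "(\<lambda>n. tv_norm n (\<lambda>i. invariant_dist n (Q n \<omega>) i - recip_dist n (\<lambda>i. \<theta> i \<omega>) i))
        \<in> O(\<lambda>n. real n powr (- a))"
      by (rule bigo[OF eventually_mono[OF *]]) blast
  qed
qed

end
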